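(* Let $\mathcal V$ be a Euclidean Jordan algebra of rank $n$. Let $F:\mathcal V\to\mathbb R$ be a strictly Schur-convex spectral function with associated symmetric function $f:\mathbb R^n\to\mathbb R$, let $\Omega\subseteq\mathcal V$ be a spectral set with associated symmetric set $Q\subseteq\mathbb R^n$, and let $a\in\mathcal V$. Then: (a) If $\bar x$ is a global minimizer of $F(x-a)$ for $x\in\Omega$, then $a$ and $\bar x$ strongly operator commute. Moreover, $$\min_{x\in\Omega}F(x-a)=\min_{u\in Q}f(u-\lambda(a))=f(\lambda(\bar x)-\lambda(a)).$$ (b) If $\bar x$ is a global maximizer of $F(x-a)$ for $x\in\Omega$, then $-a$ and $\bar x$ strongly operator commute. Moreover, $$\max_{x\in\Omega}F(x-a)=\max_{u\in Q}f(u+\lambda(-a))=f(\lambda(\bar x)+\lambda(-a)).$$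
   Context: A Euclidean Jordan algebra (EJA) $\mathcal V$ is a finite-dimensional real inner product space with a commutative bilinear product $\circ$ satisfying the Jordan identity $(x\circ y)\circ(x\circ x)=x\circ(y\circ(x\circ x))$, having a unit $e$, and with $\langle x\circ y,z\rangle=\langle y,x\circ z\rangle$. A primitive idempotent is a nonzero $c$ with $c\circ c=c$ that is not a sum of two nonzero idempotents. A Jordan frame is a collection $\{e_1,\dots,e_n\}$ of primitive idempotents with $\sum_i e_i=e$ and $e_i\circ e_j=0$ for $i\ne j$; $n$ is the rank of $\mathcal V$. Every $x\in\mathcal V$ has a spectral decomposition $x=\sum_{i=1}^n\lambda_i(x)e_i$ for some Jordan frame, where $\lambda_1(x)\ge\dots\ge\lambda_n(x)$ are the (uniquely determined) eigenvalues of $x$; $\lambda(x)=(\lambda_1(x),\dots,\lambda_n(x))\in\mathbb R^n$. Two elements $a,b\in\mathcal V$ strongly operator commute if there is a single Jordan frame $\{e_1,\dots,e_n\}$ with $a=\sum_i\lambda_i(a)e_i$ and $b=\sum_i\lambda_i(b)e_i$. A set $Q\subseteq\mathbb R^n$ is symmetric if it is invariant under all coordinate permutations; $\Omega\subseteq\mathcal V$ is a spectral set with associated symmetric set $Q$ if $\Omega=\{x\in\mathcal V:\lambda(x)\in Q\}$ with $Q$ symmetric. A function $f:\mathbb R^n\to\mathbb R$ is symmetric if it is invariant under all coordinate permutations; $F:\mathcal V\to\mathbb R$ is a spectral function with associated symmetric function $f$ if $f$ is symmetric and $F(x)=f(\lambda(x))$ for all $x$. For $u\in\mathbb R^n$,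 $u^\downarrow$ is the nonincreasing rearrangement of $u$. One writes $u\prec v$ if $\sum_{i=1}^k u_i^\downarrow\le\sum_{i=1}^k v_i^\downarrow$ for $k=1,\dots,n$, with equality for $k=n$. A function $f$ is strictly Schur-convex if $u\prec v$ implies $f(u)\le f(v)$, and $f(u)<f(v)$ whenever $u\prec v$ and $u^\downarrow\ne v^\downarrow$. A spectral function $F$ is strictly Schur-convex if its associated symmetric function $f$ is. *)

theory Defs
  imports "HOL-Analysis.Analysis"
begin

text \<open>The inner product of the algebra is that of the ambient type; the Jordan product and the
  unit are explicit parameters.\<close>

locale euclidean_jordan_algebra =
  fixes jp :: "'v::euclidean_space \<Rightarrow> 'v \<Rightarrow> 'v" and e :: 'v
  assumes jp_bilinear: "bilinear jp"
    and jp_commute: "jp x y = jp y x"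
    and jordan_identity: "jp (jp x y) (jp x x) = jp x (jp y (jp x x))"
    and jp_unit: "jp x e = x"
    and jp_inner: "jp x y \<bullet> z = y \<bullet> jp x z"

definition primitive_idempotent :: "('v::real_vector \<Rightarrow> 'v \<Rightarrow> 'v) \<Rightarrow> 'v \<Rightarrow> bool" where
  "primitive_idempotent jp c \<longleftrightarrow> c \<noteq> 0 \<and> jp c c = c \<and>
     \<not> (\<exists>p q. p \<noteq> 0 \<and> jp p p = p \<and> q \<noteq> 0 \<and> jp q q = q \<and> c = p + q)"

definition jordan_frame :: "('v::real_vector \<Rightarrow> 'v \<Rightarrow> 'v) \<Rightarrow> 'v \<Rightarrow> 'v set \<Rightarrow> bool" where
  "jordan_frame jp e C \<longleftrightarrow> finite C \<and> (\<forall>c\<in>C. primitive_idempotent jp c) \<and> \<Sum>C = e \<and>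
     (\<forall>c\<in>C. \<forall>d\<in>C. c \<noteq> d \<longrightarrow> jp c d = 0)"

text \<open>All Jordan frames of a Euclidean Jordan algebra have the same number of elements, so one
  frame determines the rank.\<close>

definition has_rank :: "('v::real_vector \<Rightarrow> 'v \<Rightarrow> 'v) \<Rightarrow> 'v \<Rightarrow> nat \<Rightarrow> bool" where
  "has_rank jp e n \<longleftrightarrow> (\<exists>C. jordan_frame jp e C \<and> card C = n)"

text \<open>The coordinates $1, \dots, n$ are the elements of a finite linearly ordered type
  \<open>'n\<close>, in increasing order, and \<open>e\<^sub>1, \<dots>, e\<^sub>n\<close> is an injective family over it.\<close>

definition indexed_jordan_frame ::
    "('v::real_vector \<Rightarrow> 'v \<Rightarrow> 'v) \<Rightarrow> 'v \<Rightarrow> ('n::finite \<Rightarrow> 'v) \<Rightarrow> bool" where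
  "indexed_jordan_frame jp e c \<longleftrightarrow> inj c \<and> jordan_frame jp e (range c)"

definition nonincreasing :: "real ^ 'n::{finite,linorder} \<Rightarrow> bool" where
  "nonincreasing u \<longleftrightarrow> (\<forall>i j. i \<le> j \<longrightarrow> u $ j \<le> u $ i)"

definition eigenvalues ::
    "('v::real_vector \<Rightarrow> 'v \<Rightarrow> 'v) \<Rightarrow> 'v \<Rightarrow> 'v \<Rightarrow> real ^ 'n::{finite,linorder}" where
  "eigenvalues jp e x = (THE l. nonincreasing l \<and>
     (\<exists>c. indexed_jordan_frame jp e c \<and> x = (\<Sum>i\<in>UNIV. (l $ i) *\<^sub>R c i)))"

text \<open>The type argument only selects the index type.\<close>

definition strongly_operator_commute ::
    "'n::{finite,linorder} itself \<Rightarrow> ('v::real_vector \<Rightarrow> 'v \<Rightarrow> 'v) \<Rightarrow> 'v \<Rightarrow> 'v \<Rightarrow> 'v \<Rightarrow> bool" where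
  "strongly_operator_commute N jp e a b \<longleftrightarrow>
     (\<exists>c :: 'n \<Rightarrow> 'v. indexed_jordan_frame jp e c \<and>
        a = (\<Sum>i\<in>UNIV. (eigenvalues jp e a $ i) *\<^sub>R c i) \<and>
        b = (\<Sum>i\<in>UNIV. (eigenvalues jp e b $ i) *\<^sub>R c i))"

definition permute_coords :: "('n::finite \<Rightarrow> 'n) \<Rightarrow> real ^ 'n::finite \<Rightarrow> real ^ 'n::finite" where
  "permute_coords p u = (\<chi> i. u $ p i)"

definition symmetric_set :: "(real ^ 'n::finite) set \<Rightarrow> bool" where
  "symmetric_set Q \<longleftrightarrow> (\<forall>p. bij p \<longrightarrow> (\<forall>u\<in>Q. permute_coords p u \<in> Q))"

definition symmetric_function :: "(real ^ 'n::finite \<Rightarrow> real) \<Rightarrow> bool" where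
  "symmetric_function f \<longleftrightarrow> (\<forall>p. bij p \<longrightarrow> (\<forall>u. f (permute_coords p u) = f u))"

definition spectral_set ::
    "('v::real_vector \<Rightarrow> 'v \<Rightarrow> 'v) \<Rightarrow> 'v \<Rightarrow> 'v set \<Rightarrow> (real ^ 'n::{finite,linorder}) set \<Rightarrow> bool" where
  "spectral_set jp e \<Omega> Q \<longleftrightarrow> symmetric_set Q \<and> \<Omega> = {x. eigenvalues jp e x \<in> Q}"

definition spectral_function ::
    "('v::real_vector \<Rightarrow> 'v \<Rightarrow> 'v) \<Rightarrow> 'v \<Rightarrow> ('v \<Rightarrow> real) \<Rightarrow>
     (real ^ 'n::{finite,linorder} \<Rightarrow> real) \<Rightarrow> bool" where
  "spectral_function jp e F f \<longleftrightarrow> symmetric_function f \<and> (\<forall>x. F x = f (eigenvalues jp e x))"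

definition decreasing_rearrangement ::
    "real ^ 'n::{finite,linorder} \<Rightarrow> real ^ 'n::{finite,linorder}" where
  "decreasing_rearrangement u = (THE v. nonincreasing v \<and> (\<exists>p. bij p \<and> v = permute_coords p u))"

definition majorized :: "real ^ 'n::{finite,linorder} \<Rightarrow> real ^ 'n::{finite,linorder} \<Rightarrow> bool" where
  "majorized u v \<longleftrightarrow>
     (\<forall>k. (\<Sum>i\<in>{..k}. decreasing_rearrangement u $ i) \<le> (\<Sum>i\<in>{..k}. decreasing_rearrangement v $ i)) \<and>
     (\<Sum>i\<in>UNIV. decreasing_rearrangement u $ i) = (\<Sum>i\<in>UNIV. decreasing_rearrangement v $ i)"

definition strictly_schur_convex :: "(real ^ 'n::{finite,linorder} \<Rightarrow> real) \<Rightarrow> bool" where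
  "strictly_schur_convex f \<longleftrightarrow>
     (\<forall>u v. majorized u v \<longrightarrow> f u \<le> f v) \<and>
     (\<forall>u v. majorized u v \<and> decreasing_rearrangement u \<noteq> decreasing_rearrangement v \<longrightarrow> f u < f v)"

definition has_minimum :: "('a \<Rightarrow> real) \<Rightarrow> 'a set \<Rightarrow> real \<Rightarrow> bool" where
  "has_minimum g S m \<longleftrightarrow> m \<in> g ` S \<and> (\<forall>x\<in>S. m \<le> g x)"

definition has_maximum :: "('a \<Rightarrow> real) \<Rightarrow> 'a set \<Rightarrow> real \<Rightarrow> bool" where
  "has_maximum g S m \<longleftrightarrow> m \<in> g ` S \<and> (\<forall>x\<in>S. g x \<le> m)"

end

theory Submission
  imports Defs
begin

text \<open>If \<open>c\<close> and \<open>d\<close> are primitive idempotents with \<open>c \<bullet> d \<noteq> 0\<close>, then \<open>|c| = |d|\<close>; hence for any two Jordan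
  frames the numbers \<open>(c\<^sub>i \<bullet> d\<^sub>j) / |c\<^sub>i|\<^sup>2\<close> form a doubly stochastic matrix. This yields the Ky Fan
  principle for sums of the largest eigenvalues, so that \<open>\<lambda>(x + y) \<prec> \<lambda>(x) + \<lambda>(y)\<close>, and, integrating
  subgradients along a segment, Lidskii's relation \<open>\<lambda>(x) - \<lambda>(a) \<prec> \<lambda>(x - a)\<close>. An optimal point forces
  equality in the relevant majorization by strictness. In the sum case the frame of \<open>x + y\<close> then
  diagonalises both \<open>x\<close> and \<open>y\<close>; the difference case reduces to it by the parallelogram law for the
  trace form.\<close>

text \<open>The given inner product need not be the trace form: on a direct sum it can be rescaled
  on each summand, so primitive idempotents can differ in length, and raw inner products with a
  frame need not sum to 1. Dividing by the squared length repairs the rows; the columns follow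
  because unequal lengths occur only between orthogonal primitives. Strictness is triggered by a
  competitor: the coordinates \<open>eig xb\<close> placed on a frame of \<open>a\<close> give a
  point of \<open>\<Omega>\<close> with objective value \<open>f (eig xb - eig a)\<close>, and
  optimality of \<open>xb\<close> reverses the inequality coming from Schur-convexity. For a
  minimizer this yields only that \<open>eig (xb - a)\<close> is some permutation of
  \<open>eig xb - eig a\<close>, and the Lidskii argument, a limit over subdivisions, leaves no
  equality to trace back to the frames. What survives a permutation is the Euclidean norm, which is
  exactly what the parallelogram law can use. For a maximizer the sum
  \<open>eig xb + eig (- a)\<close> is already sorted, so the equality is entrywise.\<close>

section \<open>Eigenvectors of self-adjoint maps\<close>

text \<open>Maximise the Rayleigh quotient over the unit sphere of \<open>W\<close>; perturbing the
  maximiser \<open>y\<close> along the residual \<open>B\<close> stays in \<open>W\<close> and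
  forces \<open>B = 0\<close>.\<close>

lemma selfadjoint_eigenvector_exists:
  fixes T :: "'v::euclidean_space \<Rightarrow> 'v"
  assumes lin: "linear T" and sym: "\<And>x y. T x \<bullet> y = x \<bullet> T y"
    and W: "subspace W" "\<And>w. w \<in> W \<Longrightarrow> T w \<in> W" "W \<noteq> {0}"
  obtains w \<mu> where "w \<in> W" "w \<noteq> 0" "T w = \<mu> *\<^sub>R w"
proof -
  obtain w0 where w0: "w0 \<in> W" "w0 \<noteq> 0" using W(1,3) subspace_0 by blast
  define S where "S = W \<inter> sphere 0 1"
  have "compact S" unfolding S_def
    using closed_subspace[OF W(1)] compact_sphere by (simp add: closed_Int_compact)
  moreover have "(1 / norm w0) *\<^sub>R w0 \<in> S"
    unfolding S_def using w0 subspace_scale[OF W(1)] by simp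
  moreover have "continuous_on S (\<lambda>y. T y \<bullet> y)"
    using lin by (intro continuous_intros linear_continuous_on)
      (simp add: linear_conv_bounded_linear)
  ultimately obtain y where y: "y \<in> S" "\<And>z. z \<in> S \<Longrightarrow> T z \<bullet> z \<le> T y \<bullet> y"
    using continuous_attains_sup[of S "\<lambda>y. T y \<bullet> y"] by blast
  define \<mu> where "\<mu> = T y \<bullet> y"
  have yW: "y \<in> W" "y \<bullet> y = 1" using y(1) unfolding S_def by (auto simp: dot_square_norm)
  have q: "T z \<bullet> z \<le> \<mu> * (z \<bullet> z)" if "z \<in> W" for z
  proof (cases "z = 0")
    case False
    have "(1 / norm z) *\<^sub>R z \<in> S"
      unfolding S_def using that False subspace_scale[OF W(1)] by simp
    from y(2)[OF this] have "(T z \<bullet> z) / (norm z)\<^sup>2 \<le> \<mu>"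
      unfolding \<mu>_def by (simp add: linear_scale[OF lin] power2_eq_square)
    then show ?thesis using False by (simp add: dot_square_norm field_simps)
  qed (simp add: linear_0[OF lin])
  define B where "B = \<mu> *\<^sub>R y - T y"
  have BW: "B \<in> W" unfolding B_def using yW W by (simp add: subspace_diff subspace_scale)
  have key: "0 \<le> 2 * t * (B \<bullet> B) + t\<^sup>2 * (\<mu> * (B \<bullet> B) - T B \<bullet> B)" for t
  proof -
    have "y + t *\<^sub>R B \<in> W" using yW BW W by (simp add: subspace_add subspace_scale)
    note q' = q[OF this]
    have "T B \<bullet> y = T y \<bullet> B" using sym[of B y] by (simp add: inner_commute)
    then have lhs: "T (y + t *\<^sub>R B) \<bullet> (y + t *\<^sub>R B) = \<mu> + 2 * (t * (T y \<bullet> B)) + t\<^sup>2 * (T B \<bullet> B)"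
      by (simp add: linear_add[OF lin] linear_scale[OF lin] inner_add_left inner_add_right \<mu>_def
          power2_eq_square distrib_left)
    have "(y + t *\<^sub>R B) \<bullet> (y + t *\<^sub>R B) = 1 + 2 * (t * (y \<bullet> B)) + t\<^sup>2 * (B \<bullet> B)"
      using yW(2) by (simp add: inner_add_left inner_add_right inner_commute[of B y] power2_eq_square
          distrib_left)
    then have rhs: "\<mu> * ((y + t *\<^sub>R B) \<bullet> (y + t *\<^sub>R B))
        = \<mu> + 2 * (t * (\<mu> * (y \<bullet> B))) + t\<^sup>2 * (\<mu> * (B \<bullet> B))"
      by (simp only:) (simp add: algebra_simps)
    have "B \<bullet> B = \<mu> * (y \<bullet> B) - T y \<bullet> B"
      by (subst (1) B_def) (simp add: inner_diff_left)
    from arg_cong[OF this, of "(*) t"]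
    have "t * (B \<bullet> B) = t * (\<mu> * (y \<bullet> B)) - t * (T y \<bullet> B)"
      by (simp only: right_diff_distrib)
    then show ?thesis using q' unfolding lhs rhs right_diff_distrib by linarith
  qed
  have "B \<bullet> B = 0"
  proof (rule ccontr)
    assume "B \<bullet> B \<noteq> 0"
    then have pos: "B \<bullet> B > 0" by simp
    \<comment> \<open>\<open>K\<close> bounds the quadratic coefficient and is positive thanks to
      the \<open>+ 1\<close>. With \<open>b = B \<bullet> B\<close>, the chosen \<open>t\<close>
      minimises \<open>2 t b + t\<^sup>2 K\<close>, whose minimum \<open>- b\<^sup>2 / K\<close> is
      negative.\<close>
    define K where "K = \<bar>\<mu> * (B \<bullet> B) - T B \<bullet> B\<bar> + 1"
    define t where "t = - (B \<bullet> B) / K"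
    have K: "K > 0" unfolding K_def by simp
    have "t\<^sup>2 * (\<mu> * (B \<bullet> B) - T B \<bullet> B) \<le> t\<^sup>2 * K"
      unfolding K_def by (intro mult_left_mono) auto
    also have "\<dots> = (B \<bullet> B)\<^sup>2 / K" using K unfolding t_def by (simp add: power2_eq_square)
    finally have "0 \<le> 2 * t * (B \<bullet> B) + (B \<bullet> B)\<^sup>2 / K" using key[of t] by linarith
    also have "\<dots> = - ((B \<bullet> B)\<^sup>2 / K)" unfolding t_def by (simp add: power2_eq_square)
    finally have "(B \<bullet> B)\<^sup>2 / K \<le> 0" by simp
    moreover have "(B \<bullet> B)\<^sup>2 / K > 0" using pos K by (intro divide_pos_pos) auto
    ultimately show False by linarith
  qed
  then have "T y = \<mu> *\<^sub>R y" unfolding B_def by simp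
  moreover have "y \<noteq> 0" using yW(2) by auto
  ultimately show ?thesis using that yW(1) by blast
qed

text \<open>Within \<open>A\<close>, the orthogonal complement of the eigenvectors is invariant, so
  it would contain an eigenvector unless it is zero. Indexing components by eigenvalue merges those
  with equal eigenvalues.\<close>

lemma selfadjoint_eigen_decomposition:
  fixes T :: "'v::euclidean_space \<Rightarrow> 'v"
  assumes lin: "linear T" and sym: "\<And>x y. T x \<bullet> y = x \<bullet> T y"
    and A: "subspace A" "\<And>w. w \<in> A \<Longrightarrow> T w \<in> A" and v: "v \<in> A"
  obtains M g where "finite M" "\<And>\<mu>. g \<mu> \<in> A" "\<And>\<mu>. T (g \<mu>) = \<mu> *\<^sub>R g \<mu>" "v = (\<Sum>\<mu>\<in>M. g \<mu>)"
proof -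
  define E where "E = {w \<in> A. \<exists>\<mu>. T w = \<mu> *\<^sub>R w}"
  define W where "W = {w \<in> A. \<forall>z \<in> E. z \<bullet> w = 0}"
  have "subspace W" unfolding W_def subspace_def
    using A(1) by (auto simp: inner_add_right subspace_0 subspace_add subspace_scale)
  moreover have "T w \<in> W" if "w \<in> W" for w
    using that A(2) unfolding W_def E_def by (auto simp flip: sym)
  ultimately have "W = {0}"
  proof (rule_tac ccontr)
    assume a: "subspace W" "\<And>w. w \<in> W \<Longrightarrow> T w \<in> W" "W \<noteq> {0}"
    obtain w \<mu> where w: "w \<in> W" "w \<noteq> 0" "T w = \<mu> *\<^sub>R w"
      using selfadjoint_eigenvector_exists[OF lin sym a] by blast
    then have "w \<in> E" unfolding E_def W_def by auto
    with w show False unfolding W_def by auto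
  qed
  obtain y z where yz: "y \<in> span E" "\<And>w. w \<in> span E \<Longrightarrow> orthogonal z w" "v = y + z"
    using orthogonal_subspace_decomp_exists[of E v] by metis
  have "span E \<subseteq> A" using A(1) by (intro span_minimal) (auto simp: E_def)
  then have "z \<in> A" using yz v A(1) by (metis add_diff_cancel_left' subsetD subspace_diff)
  then have "z \<in> W" unfolding W_def using yz(2)
    by (auto simp: orthogonal_def inner_commute span_base)
  then have vE: "v \<in> span E" using yz \<open>W = {0}\<close> by simp
  have "\<exists>M g. finite M \<and> (\<forall>\<mu>. g \<mu> \<in> A) \<and> (\<forall>\<mu>. T (g \<mu>) = \<mu> *\<^sub>R g \<mu>) \<and> v = (\<Sum>\<mu>\<in>M. g \<mu>)"
    using vE
  proof (induction rule: span_induct_alt)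
    case base
    show ?case using A(1) linear_0[OF lin]
      by (intro exI[of _ "{}"] exI[of _ "\<lambda>_. 0"]) (auto simp: subspace_0)
  next
    case (step k w u)
    then obtain M g where g: "finite M" "\<And>\<mu>. g \<mu> \<in> A" "\<And>\<mu>. T (g \<mu>) = \<mu> *\<^sub>R g \<mu>"
      "u = (\<Sum>\<mu>\<in>M. g \<mu>)" by blast
    obtain \<nu> where \<nu>: "w \<in> A" "T w = \<nu> *\<^sub>R w" using step(1) unfolding E_def by blast
    \<comment> \<open>\<open>g\<close> may be nonzero off \<open>M\<close>; without the cut-off a
      stray \<open>g \<nu>\<close> would enter the sum when \<open>\<nu>\<close> is new.\<close>
    define h where "h = (\<lambda>\<mu>. (if \<mu> \<in> M then g \<mu> else 0) + (if \<mu> = \<nu> then k *\<^sub>R w else 0))"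
    have "(\<Sum>\<mu>\<in>insert \<nu> M. h \<mu>) = (\<Sum>\<mu>\<in>insert \<nu> M. if \<mu> \<in> M then g \<mu> else 0)
        + (\<Sum>\<mu>\<in>insert \<nu> M. if \<mu> = \<nu> then k *\<^sub>R w else 0)"
      unfolding h_def by (simp add: sum.distrib)
    also have "(\<Sum>\<mu>\<in>insert \<nu> M. if \<mu> = \<nu> then k *\<^sub>R w else 0) = k *\<^sub>R w"
      using g(1) by (subst sum.delta) auto
    also have "(\<Sum>\<mu>\<in>insert \<nu> M. if \<mu> \<in> M then g \<mu> else 0) = (\<Sum>\<mu>\<in>M. g \<mu>)"
      using g(1) by (intro sum.mono_neutral_cong_right) auto
    finally have "(\<Sum>\<mu>\<in>insert \<nu> M. h \<mu>) = k *\<^sub>R w + u" using g(4) by simp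
    moreover have "h \<mu> \<in> A" "T (h \<mu>) = \<mu> *\<^sub>R h \<mu>" for \<mu>
      using A(1) g(2,3) \<nu> unfolding h_def
      by (auto simp: subspace_0 subspace_add subspace_scale linear_add[OF lin]
          linear_scale[OF lin] linear_0[OF lin] algebra_simps)
    ultimately show ?case using g(1)
      by (intro exI[of _ "insert \<nu> M"] exI[of _ h]) auto
  qed
  then show ?thesis using that by blast
qed

section \<open>Idempotents and the spectral theorem\<close>

context euclidean_jordan_algebra
begin

lemma jp_linear_right: "linear (jp x)"
  using jp_bilinear unfolding bilinear_def by simp

lemma jp_linear_left: "linear (\<lambda>x. jp x y)"
  using jp_bilinear unfolding bilinear_def by simp

lemmas jp_add_right = linear_add[OF jp_linear_right]
  and jp_diff_right = linear_diff[OF jp_linear_right]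
  and jp_scaleR_right = linear_scale[OF jp_linear_right]
  and jp_sum_right = linear_sum[OF jp_linear_right]
  and jp_zero_right = linear_0[OF jp_linear_right]
  and jp_add_left = linear_add[OF jp_linear_left]
  and jp_diff_left = linear_diff[OF jp_linear_left]
  and jp_scaleR_left = linear_scale[OF jp_linear_left]
  and jp_sum_left = linear_sum[OF jp_linear_left]
  and jp_zero_left = linear_0[OF jp_linear_left]

lemmas jp_simps = jp_add_right jp_diff_right jp_scaleR_right jp_zero_right
  jp_add_left jp_diff_left jp_scaleR_left jp_zero_left

section \<open>Associativity of the inner product and linearised Jordan identities\<close>

lemma jp_self_adjoint: "jp c x \<bullet> y = x \<bullet> jp c y"
  by (metis jp_commute jp_inner)

lemma jp_inner_unit: "jp x y \<bullet> e = x \<bullet> y"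
  by (metis inner_commute jp_self_adjoint jp_unit)

lemma jp_unit_left: "jp e x = x"
  by (metis jp_commute jp_unit)

lemma jordan_linearised:
  "jp x (jp (jp c c) v) + 2 *\<^sub>R jp c (jp (jp x c) v) = jp (jp c c) (jp x v) + 2 *\<^sub>R jp (jp x c) (jp c v)"
proof -
  define J where "J = (\<lambda>y. jp (jp y v) (jp y y) - jp y (jp v (jp y y)))"
  have J0: "J y = 0" for y unfolding J_def by (simp add: jordan_identity)
  \<comment> \<open>\<open>J\<close> is a cubic form in \<open>y\<close>; this combination keeps
    just the part linear in \<open>x\<close>.\<close>
  have "J (c + x) - J (c - x) - 2 *\<^sub>R J x = 2 *\<^sub>R (jp (jp x v) (jp c c) + 2 *\<^sub>R jp (jp c v) (jp x c)
      - jp x (jp v (jp c c)) - 2 *\<^sub>R jp c (jp v (jp x c)))"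
    unfolding J_def by (simp add: jp_simps jp_commute[of c x] algebra_simps scaleR_2)
  then have "jp (jp x v) (jp c c) + 2 *\<^sub>R jp (jp c v) (jp x c)
      - jp x (jp v (jp c c)) - 2 *\<^sub>R jp c (jp v (jp x c)) = 0"
    using J0 by simp
  then show ?thesis
    by (simp add: jp_commute[of v] jp_commute[of "jp x v"] jp_commute[of "jp c v"] algebra_simps)
qed

text \<open>The defect of the previous identity is a quadratic form in \<open>c\<close>, so its
  polarisation vanishes too.\<close>

lemma jordan_linearised3:
  "jp x (jp (jp y z) v) + jp y (jp (jp x z) v) + jp z (jp (jp x y) v)
   = jp (jp y z) (jp x v) + jp (jp x z) (jp y v) + jp (jp x y) (jp z v)"
proof -
  define K where "K = (\<lambda>c. jp x (jp (jp c c) v) + 2 *\<^sub>R jp c (jp (jp x c) v)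
    - jp (jp c c) (jp x v) - 2 *\<^sub>R jp (jp x c) (jp c v))"
  have K0: "K c = 0" for c using jordan_linearised[of x c v] by (simp add: K_def)
  have "K (y + z) - K y - K z = 2 *\<^sub>R (jp x (jp (jp y z) v) + jp y (jp (jp x z) v)
      + jp z (jp (jp x y) v) - jp (jp y z) (jp x v) - jp (jp x z) (jp y v) - jp (jp x y) (jp z v))"
    unfolding K_def by (simp add: jp_simps jp_commute[of z y] algebra_simps scaleR_2)
  then have "jp x (jp (jp y z) v) + jp y (jp (jp x z) v) + jp z (jp (jp x y) v)
      - jp (jp y z) (jp x v) - jp (jp x z) (jp y v) - jp (jp x y) (jp z v) = 0"
    using K0 by simp
  then show ?thesis by (simp add: algebra_simps)
qed

text \<open>The right-hand side of the linearised identity is symmetric in all four variables.\<close>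

lemma jp_triple_product:
  "jp (jp (jp y z) x) v = jp x (jp (jp y z) v) + jp y (jp (jp x z) v) + jp z (jp (jp x y) v)
     - jp y (jp x (jp z v)) - jp z (jp x (jp y v))"
proof -
  have "jp v (jp (jp y z) x) + jp y (jp (jp v z) x) + jp z (jp (jp v y) x)
      = jp x (jp (jp y z) v) + jp y (jp (jp x z) v) + jp z (jp (jp x y) v)"
    unfolding jordan_linearised3
    by (simp add: jp_commute[of v x] jp_commute[of "jp v z"] jp_commute[of "jp v y"]
        jp_commute[of "jp z v"] jp_commute[of "jp y v"] jp_commute[of v z] jp_commute[of v y]
        jp_commute[of z x] jp_commute[of y x])
  then show ?thesis
    by (simp add: jp_commute[of v] jp_commute[of "jp z v" x] jp_commute[of "jp y v" x] algebra_simps)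
qed

section \<open>Peirce calculus of an idempotent\<close>

lemma idempotent_cubic:
  assumes "jp c c = c"
  shows "2 *\<^sub>R jp c (jp c (jp c x)) - 3 *\<^sub>R jp c (jp c x) + jp c x = 0"
proof -
  \<comment> \<open>The linearised identity with \<open>v = c\<close>. It leads to
    \<open>L (2 L - 1) (L - 1) = 0\<close> for \<open>L = jp c\<close>, so the only possible
    eigenvalues are 0, 1/2 and 1.\<close>
  have "2 *\<^sub>R jp c (jp c (jp c x)) + jp c x = jp c (jp c x) + 2 *\<^sub>R jp c (jp c x)"
    using jordan_linearised[of x c c] assms
    by (simp add: jp_commute[of x c] jp_commute[of "jp x c" c] jp_commute[of "jp c x" c] add.commute)
  also have "\<dots> = (1 + 2) *\<^sub>R jp c (jp c x)" by (simp only: scaleR_left_distrib scaleR_one)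
  finally show ?thesis by (simp add: algebra_simps)
qed

lemma idempotent_fixed_commute:
  assumes "jp c c = c" "jp c x = x"
  shows "jp c (jp x v) = jp x (jp c v)"
  using jordan_linearised[of x c v] assms
  by (simp add: jp_commute[of x c] scaleR_2)

text \<open>For \<open>L = jp c\<close>, the operators \<open>2 L\<^sup>2 - L\<close> and
  \<open>4 (L - L\<^sup>2)\<close> project onto the eigenspaces for 1 and 1/2; the two terms are the
  squared components weighted by their eigenvalues.\<close>

lemma idempotent_inner_eq:
  assumes "jp c c = c"
  shows "jp c x \<bullet> x = (norm (2 *\<^sub>R jp c (jp c x) - jp c x))\<^sup>2
    + (norm (4 *\<^sub>R (jp c x - jp c (jp c x))))\<^sup>2 / 2"
proof -
  define p where "p = jp c x"
  define q where "q = jp c p"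
  have "2 *\<^sub>R jp c q = 3 *\<^sub>R q - p"
    using idempotent_cubic[OF assms, of x] unfolding p_def q_def by (simp add: algebra_simps)
  moreover have "jp c q = (1/2) *\<^sub>R (2 *\<^sub>R jp c q)" by simp
  ultimately have r: "jp c q = (3/2) *\<^sub>R q - (1/2) *\<^sub>R p"
    by (simp add: scaleR_diff_right)
  have qq: "q \<bullet> q = (3/2) * (q \<bullet> p) - (1/2) * (p \<bullet> p)"
  proof -
    have "q \<bullet> q = jp c q \<bullet> p" unfolding q_def[symmetric] by (metis jp_self_adjoint q_def)
    then show ?thesis by (simp add: r inner_diff_left)
  qed
  have "q \<bullet> x = p \<bullet> p" unfolding q_def p_def by (simp add: jp_self_adjoint)
  moreover have "q \<bullet> p = jp c q \<bullet> x" by (metis jp_self_adjoint p_def)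
  ultimately have qp: "q \<bullet> p = (3/2) * (p \<bullet> p) - (1/2) * (p \<bullet> x)"
    by (simp add: r inner_diff_left)
  show ?thesis unfolding p_def[symmetric] q_def[symmetric] power2_norm_eq_inner
    using qq qp by (simp add: inner_diff_left inner_diff_right inner_commute[of p q] field_simps)
qed

lemma idempotent_inner_nonneg:
  assumes "jp c c = c" "jp d d = d"
  shows "0 \<le> c \<bullet> d"
proof -
  have "c \<bullet> d = jp c d \<bullet> d" by (metis assms(2) jp_commute jp_inner)
  then show ?thesis using idempotent_inner_eq[OF assms(1), of d] by simp
qed

text \<open>Equality case of \<open>idempotent_inner_nonneg\<close>: the Peirce components of
  \<open>d\<close> for the eigenvalues 1 and 1/2 both vanish.\<close>

lemma idempotent_orthogonal:
  assumes "jp c c = c" "jp d d = d" "c \<bullet> d = 0"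
  shows "jp c d = 0"
proof -
  have "c \<bullet> d = jp c d \<bullet> d" by (metis assms(2) jp_commute jp_inner)
  then have "(norm (2 *\<^sub>R jp c (jp c d) - jp c d))\<^sup>2
      + (norm (4 *\<^sub>R (jp c d - jp c (jp c d))))\<^sup>2 / 2 = 0"
    using idempotent_inner_eq[OF assms(1), of d] assms(3) by linarith
  then show ?thesis by (subst (asm) add_nonneg_eq_0_iff) (auto simp: scaleR_2)
qed

lemma idempotent_inner_zero:
  assumes "jp c c = c" "jp c d = 0"
  shows "c \<bullet> d = 0"
  by (metis assms inner_zero_right jp_inner)

lemma idempotent_sum_orthogonal:
  assumes "jp p p = p" "jp q q = q" "jp (p + q) (p + q) = p + q"
  shows "jp p q = 0"
proof -
  have "jp p q + jp p q = 0" using assms by (simp add: jp_simps jp_commute[of q p])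
  then show ?thesis by (simp flip: scaleR_2)
qed

text \<open>Multiplication by the square is in general not a polynomial in multiplication by
  \<open>x\<close>, so commuting with it is a separate demand; the formula in
  \<open>bicomm_jp_jp\<close> involves both.\<close>

definition comm_ops :: "'v \<Rightarrow> ('v \<Rightarrow> 'v) set" where
  "comm_ops x = {T. linear T \<and> (\<forall>v. T (jp x v) = jp x (T v)) \<and>
     (\<forall>v. T (jp (jp x x) v) = jp (jp x x) (T v))}"

text \<open>The multiplications commuting with everything that commutes with those by \<open>x\<close> and
  \<open>x\<^sup>2\<close>; this replaces the algebra generated by \<open>x\<close> and makes power associativity unnecessary.\<close>

definition bicomm :: "'v \<Rightarrow> 'v set" where
  "bicomm x = {a. \<forall>T\<in>comm_ops x. \<forall>v. T (jp a v) = jp a (T v)}"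

lemma jp_square_commute: "jp (jp x x) (jp x v) = jp x (jp (jp x x) v)"
  by (metis jordan_identity jp_commute)

lemma jp_in_comm_ops: "jp x \<in> comm_ops x" "jp (jp x x) \<in> comm_ops x"
  by (simp_all add: comm_ops_def jp_linear_right jp_square_commute)

lemma subspace_bicomm: "subspace (bicomm x)"
  by (auto simp: subspace_def bicomm_def comm_ops_def jp_simps linear_0 linear_add linear_scale)

lemma bicomm_unit: "e \<in> bicomm x"
  by (simp add: bicomm_def jp_unit_left)

lemma bicomm_self: "x \<in> bicomm x"
  by (simp add: bicomm_def comm_ops_def)

text \<open>The triple product formula writes this multiplication as a polynomial in those by
  \<open>x\<close>, its square, \<open>a\<close> and \<open>jp x a\<close>, each of which commutes
  with \<open>T\<close>.\<close>

lemma bicomm_jp_jp: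
  assumes "a \<in> bicomm x" "jp x a \<in> bicomm x"
  shows "jp x (jp x a) \<in> bicomm x"
proof -
  have eq: "jp (jp x (jp x a)) v = 2 *\<^sub>R jp x (jp (jp x a) v) + jp a (jp (jp x x) v)
      - jp a (jp x (jp x v)) - jp x (jp x (jp a v))" for v
    using jp_triple_product[of a x x v] by (simp add: jp_commute[of a x] jp_commute[of "jp x a" x] scaleR_2)
  have "T (jp (jp x (jp x a)) v) = jp (jp x (jp x a)) (T v)" if T: "T \<in> comm_ops x" for T v
  proof -
    have "linear T" "\<And>v. T (jp x v) = jp x (T v)" "\<And>v. T (jp (jp x x) v) = jp (jp x x) (T v)"
      using T by (auto simp: comm_ops_def)
    moreover have "\<And>v. T (jp a v) = jp a (T v)" "\<And>v. T (jp (jp x a) v) = jp (jp x a) (T v)"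
      using assms T by (auto simp: bicomm_def)
    ultimately show ?thesis
      unfolding eq by (simp add: linear_add linear_diff linear_scale)
  qed
  then show ?thesis by (simp add: bicomm_def)
qed

text \<open>The closure step \<open>bicomm_jp_jp\<close> needs two consecutive members, so
  invariance under \<open>jp x\<close> is obtained for pairs.\<close>

definition bicomm_powers :: "'v \<Rightarrow> 'v set" where
  "bicomm_powers x = {a \<in> bicomm x. jp x a \<in> bicomm x}"

lemma subspace_bicomm_powers: "subspace (bicomm_powers x)"
  using subspace_bicomm[of x] by (auto simp: subspace_def bicomm_powers_def jp_simps)

lemma bicomm_commute:
  assumes "a \<in> bicomm x" "b \<in> bicomm x"
  shows "jp a (jp b v) = jp b (jp a v)"
proof -
  have "jp a \<in> comm_ops x"
    using assms(1) jp_in_comm_ops[of x] by (auto simp: bicomm_def comm_ops_def jp_linear_right)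
  then show ?thesis using assms(2) by (simp add: bicomm_def)
qed

text \<open>Decompose the unit itself into eigenvectors of \<open>jp x\<close>. A product of
  components for distinct eigenvalues is an eigenvector for both, hence zero; multiplying the
  decomposition by one component then gives idempotency.\<close>

lemma spectral_idempotents:
  obtains M g where "finite M" "\<And>\<mu>. g \<mu> \<in> bicomm x" "\<And>\<mu>. jp x (g \<mu>) = \<mu> *\<^sub>R g \<mu>"
    "\<And>\<mu>. \<mu> \<in> M \<Longrightarrow> jp (g \<mu>) (g \<mu>) = g \<mu>" "\<And>\<mu> \<nu>. \<mu> \<noteq> \<nu> \<Longrightarrow> jp (g \<mu>) (g \<nu>) = 0"
    "e = (\<Sum>\<mu>\<in>M. g \<mu>)"
proof -
  have "e \<in> bicomm_powers x" by (simp add: bicomm_powers_def bicomm_unit bicomm_self jp_unit)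
  moreover have "jp x a \<in> bicomm_powers x" if "a \<in> bicomm_powers x" for a
    using that by (simp add: bicomm_powers_def bicomm_jp_jp)
  ultimately obtain M g where g: "finite M" "\<And>\<mu>. g \<mu> \<in> bicomm_powers x"
    "\<And>\<mu>. jp x (g \<mu>) = \<mu> *\<^sub>R g \<mu>" "e = (\<Sum>\<mu>\<in>M. g \<mu>)"
    using selfadjoint_eigen_decomposition[OF jp_linear_right jp_self_adjoint subspace_bicomm_powers]
    by metis
  have gb: "g \<mu> \<in> bicomm x" for \<mu> using g(2) by (simp add: bicomm_powers_def)
  have orth: "jp (g \<mu>) (g \<nu>) = 0" if "\<mu> \<noteq> \<nu>" for \<mu> \<nu>
  proof -
    have "\<nu> *\<^sub>R jp (g \<mu>) (g \<nu>) = jp x (jp (g \<mu>) (g \<nu>))" for \<mu> \<nu>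
      using bicomm_commute[OF gb bicomm_self, of \<mu> "g \<nu>"] by (simp add: g(3) jp_simps)
    from this[of \<nu> \<mu>] this[of \<mu> \<nu>] show ?thesis
      using that by (metis jp_commute scaleR_cancel_right)
  qed
  have "jp (g \<mu>) (g \<mu>) = g \<mu>" if "\<mu> \<in> M" for \<mu>
  proof -
    have "g \<mu> = (\<Sum>\<nu>\<in>M. jp (g \<mu>) (g \<nu>))"
      using jp_unit[of "g \<mu>"] by (simp add: g(4) jp_sum_right)
    also have "\<dots> = jp (g \<mu>) (g \<mu>)"
      using g(1) that orth by (subst sum.remove[of _ \<mu>]) auto
    finally show ?thesis by simp
  qed
  then show ?thesis using that g(1,3,4) gb orth by blast
qed

section \<open>Primitive idempotents and their compressions\<close>

lemma primitive_idempotentD: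
  assumes "primitive_idempotent jp c"
  shows "c \<noteq> 0" "jp c c = c" "c \<bullet> c > 0"
  using assms by (auto simp: primitive_idempotent_def)

text \<open>Each spectral idempotent \<open>g \<mu>\<close> of \<open>x\<close> with
  \<open>\<mu>\<close> nonzero is fixed by \<open>jp c\<close>, so \<open>c - g \<mu>\<close> is
  idempotent and primitivity leaves only \<open>g \<mu> = 0\<close> or \<open>g \<mu> = c\<close>.
  The component for eigenvalue 0 contributes nothing to \<open>x\<close>.\<close>

lemma primitive_fixed_space:
  assumes c: "primitive_idempotent jp c" and x: "jp c x = x"
  shows "\<exists>\<mu>. x = \<mu> *\<^sub>R c"
proof -
  note cc = primitive_idempotentD(2)[OF c]
  obtain M g where g: "finite M" "\<And>\<mu>. g \<mu> \<in> bicomm x" "\<And>\<mu>. jp x (g \<mu>) = \<mu> *\<^sub>R g \<mu>"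
    "\<And>\<mu>. \<mu> \<in> M \<Longrightarrow> jp (g \<mu>) (g \<mu>) = g \<mu>" "e = (\<Sum>\<mu>\<in>M. g \<mu>)"
    using spectral_idempotents[of x] by metis
  have comm: "jp c (jp x v) = jp x (jp c v)" for v
    by (rule idempotent_fixed_commute[OF cc x])
  have "jp c (jp x x) = jp x x" using comm[of x] x by simp
  from idempotent_fixed_commute[OF cc this] comm have C: "jp c \<in> comm_ops x"
    by (simp add: comm_ops_def jp_linear_right)
  have "\<mu> *\<^sub>R g \<mu> \<in> span {c}" if "\<mu> \<in> M" for \<mu>
  proof (cases "\<mu> = 0 \<or> g \<mu> = 0")
    case False
    have "jp c (jp (g \<mu>) x) = jp (g \<mu>) (jp c x)" using g(2) C unfolding bicomm_def by blast
    then have "\<mu> *\<^sub>R jp c (g \<mu>) = \<mu> *\<^sub>R g \<mu>"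
      using g(3)[of \<mu>] by (simp add: x jp_commute[of "g \<mu>" x] jp_simps)
    then have 1: "jp c (g \<mu>) = g \<mu>" using False by simp
    then have "jp (c - g \<mu>) (c - g \<mu>) = c - g \<mu>"
      using g(4)[OF that] cc by (simp add: jp_simps jp_commute[of "g \<mu>" c])
    moreover have "c = g \<mu> + (c - g \<mu>)" by simp
    ultimately have "c - g \<mu> = 0"
      using c False g(4)[OF that] unfolding primitive_idempotent_def by blast
    then show ?thesis by (simp add: span_base span_scale)
  qed (auto simp: span_zero)
  then have "(\<Sum>\<mu>\<in>M. \<mu> *\<^sub>R g \<mu>) \<in> span {c}" by (rule span_sum)
  moreover have "x = (\<Sum>\<mu>\<in>M. \<mu> *\<^sub>R g \<mu>)"
    using jp_unit[of x] by (simp add: g(5) jp_sum_right g(3))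
  ultimately show ?thesis by (auto simp: span_singleton)
qed

text \<open>The left side projects onto the fixed space of \<open>jp c\<close>, which is a line;
  pairing with \<open>c\<close> determines the coefficient.\<close>

lemma primitive_compression:
  assumes c: "primitive_idempotent jp c"
  shows "2 *\<^sub>R jp c (jp c x) - jp c x = ((c \<bullet> x) / (c \<bullet> c)) *\<^sub>R c"
proof -
  note cc = primitive_idempotentD(2)[OF c]
  define y where "y = 2 *\<^sub>R jp c (jp c x) - jp c x"
  have "jp c y - y = 2 *\<^sub>R jp c (jp c (jp c x)) - 3 *\<^sub>R jp c (jp c x) + jp c x"
    unfolding y_def using scaleR_left_distrib[of 1 2 "jp c (jp c x)"]
    by (simp add: jp_simps algebra_simps)
  then have "jp c y = y" using idempotent_cubic[OF cc, of x] by simp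
  then obtain \<mu> where \<mu>: "y = \<mu> *\<^sub>R c" using primitive_fixed_space[OF c] by blast
  have "y \<bullet> c = x \<bullet> c"
    unfolding y_def by (simp add: inner_diff_left jp_self_adjoint cc)
  then have "\<mu> = (c \<bullet> x) / (c \<bullet> c)"
    using primitive_idempotentD(3)[OF c] \<mu> by (simp add: field_simps inner_commute)
  then show ?thesis using \<mu> y_def by simp
qed

text \<open>Both \<open>d \<bullet> P(c) d\<close> and \<open>c \<bullet> P(d) c\<close> equal \<open>2 |c \<circ> d|\<^sup>2 - c \<bullet> d\<close>, where \<open>P(c) = 2 L(c)\<^sup>2 - L(c)\<close>.\<close>

lemma primitive_nonorthogonal_norm:
  assumes c: "primitive_idempotent jp c" and d: "primitive_idempotent jp d" and "c \<bullet> d \<noteq> 0"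
  shows "c \<bullet> c = d \<bullet> d"
proof -
  have *: "2 * (jp c d \<bullet> jp c d) - c \<bullet> d = (c \<bullet> d)\<^sup>2 / (c \<bullet> c)"
    if c: "primitive_idempotent jp c" and d: "primitive_idempotent jp d" for c d
  proof -
    have "jp c d \<bullet> d = c \<bullet> d"
      using primitive_idempotentD(2)[OF d] by (metis jp_commute jp_inner)
    then show ?thesis
      using arg_cong[OF primitive_compression[OF c, of d], of "\<lambda>y. y \<bullet> d"]
      by (simp add: inner_diff_left jp_self_adjoint power2_eq_square)
  qed
  have "(c \<bullet> d)\<^sup>2 / (c \<bullet> c) = (c \<bullet> d)\<^sup>2 / (d \<bullet> d)"
    using *[OF c d] *[OF d c] by (simp add: jp_commute inner_commute)
  then show ?thesis
    using assms(3) primitive_idempotentD(3)[OF c] primitive_idempotentD(3)[OF d]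
    by (simp add: frac_eq_eq)
qed

text \<open>A Jordan frame of eigenvectors with primitivity relaxed to being a nonzero idempotent. A
  system of maximal cardinality has only primitive members.\<close>

definition eigen_system :: "'v \<Rightarrow> 'v set \<Rightarrow> bool" where
  "eigen_system x C \<longleftrightarrow> finite C \<and> (\<forall>c\<in>C. c \<noteq> 0 \<and> jp c c = c \<and> (\<exists>\<mu>. jp x c = \<mu> *\<^sub>R c)) \<and>
     \<Sum>C = e \<and> (\<forall>c\<in>C. \<forall>d\<in>C. c \<noteq> d \<longrightarrow> jp c d = 0)"

lemma eigen_system_exists: "\<exists>C. eigen_system x C"
proof -
  obtain M g where g: "finite M" "\<And>\<mu>. jp x (g \<mu>) = \<mu> *\<^sub>R g \<mu>"
    "\<And>\<mu>. \<mu> \<in> M \<Longrightarrow> jp (g \<mu>) (g \<mu>) = g \<mu>" "\<And>\<mu> \<nu>. \<mu> \<noteq> \<nu> \<Longrightarrow> jp (g \<mu>) (g \<nu>) = 0"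
    "e = (\<Sum>\<mu>\<in>M. g \<mu>)"
    using spectral_idempotents[of x] by metis
  define M' where "M' = {\<mu>\<in>M. g \<mu> \<noteq> 0}"
  have "inj_on g M'" unfolding inj_on_def M'_def using g(3,4) by (metis (mono_tags, lifting) mem_Collect_eq)
  then have "\<Sum>(g ` M') = (\<Sum>\<mu>\<in>M'. g \<mu>)" by (simp add: sum.reindex)
  also have "\<dots> = e" unfolding g(5) M'_def using g(1) by (intro sum.mono_neutral_left) auto
  finally have "\<Sum>(g ` M') = e" .
  moreover have "jp (g \<mu>) (g \<nu>) = 0" if "g \<mu> \<noteq> g \<nu>" for \<mu> \<nu> using that g(4) by metis
  ultimately have "eigen_system x (g ` M')"
    using g(1-3) unfolding eigen_system_def M'_def by auto
  then show ?thesis by blast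
qed

lemma eigen_system_card:
  assumes "eigen_system x C"
  shows "card C \<le> DIM('v)"
proof -
  have "pairwise orthogonal C"
    using assms idempotent_inner_zero unfolding pairwise_def orthogonal_def eigen_system_def by blast
  then have "independent C"
    using assms by (intro pairwise_orthogonal_independent) (auto simp: eigen_system_def)
  then show ?thesis using independent_bound by blast
qed

text \<open>Any other member \<open>c\<close> has
  \<open>c \<bullet> p + c \<bullet> q = c \<bullet> d = 0\<close> with both terms nonnegative, so
  it annihilates \<open>p\<close> and \<open>q\<close>. Hence \<open>x\<close> acts on both by the
  eigenvalue of \<open>d\<close>.\<close>

lemma eigen_system_split:
  assumes C: "eigen_system x C" and d: "d \<in> C" "d = p + q"
    and p: "p \<noteq> 0" "jp p p = p" and q: "q \<noteq> 0" "jp q q = q"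
  shows "\<exists>C'. eigen_system x C' \<and> card C < card C'"
proof -
  note C' = C[unfolded eigen_system_def]
  have dd: "jp d d = d" using C' d(1) by blast
  have pq: "jp p q = 0"
    using idempotent_sum_orthogonal[OF p(2) q(2)] dd d(2) by simp
  then have qp: "jp q p = 0" by (metis jp_commute)
  have orth: "jp c p = 0 \<and> jp c q = 0 \<and> jp p c = 0 \<and> jp q c = 0" if c: "c \<in> C - {d}" for c
  proof -
    have cc: "jp c c = c" "jp c d = 0" using C' c d by auto
    have "c \<bullet> p + c \<bullet> q = 0"
      using idempotent_inner_zero[OF cc] d(2) by (simp add: inner_add_right)
    moreover have "c \<bullet> p \<ge> 0" "c \<bullet> q \<ge> 0" using idempotent_inner_nonneg cc p q by auto
    ultimately have "c \<bullet> p = 0" "c \<bullet> q = 0" by linarith+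
    then show ?thesis using idempotent_orthogonal cc p q jp_commute by metis
  qed
  obtain \<mu> where \<mu>: "\<And>c. c \<in> C \<Longrightarrow> jp x c = \<mu> c *\<^sub>R c" using C' by metis
  have x: "x = (\<Sum>c\<in>C. \<mu> c *\<^sub>R c)"
  proof -
    have "x = jp x (\<Sum>C)" using C' jp_unit by simp
    also have "\<dots> = (\<Sum>c\<in>C. \<mu> c *\<^sub>R c)" by (simp add: jp_sum_right \<mu>)
    finally show ?thesis .
  qed
  have xr: "jp x r = \<mu> d *\<^sub>R r" if r: "\<And>c. c \<in> C - {d} \<Longrightarrow> jp c r = 0" "jp d r = r" for r
  proof -
    have "jp x r = (\<Sum>c\<in>C. \<mu> c *\<^sub>R jp c r)"
      by (subst x) (simp add: jp_sum_left jp_scaleR_left)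
    also have "\<dots> = \<mu> d *\<^sub>R jp d r"
      using C' d(1) r(1) by (subst sum.remove[of _ d]) auto
    finally show ?thesis using r(2) by simp
  qed
  have "jp x p = \<mu> d *\<^sub>R p" using orth by (intro xr) (auto simp: d(2) jp_simps p qp)
  moreover have "jp x q = \<mu> d *\<^sub>R q" using orth by (intro xr) (auto simp: d(2) jp_simps q pq)
  moreover have notin: "p \<noteq> q" "p \<notin> C - {d}" "q \<notin> C - {d}"
    using pq p q orth by metis+
  moreover have "\<Sum>(insert p (insert q (C - {d}))) = e"
  proof -
    have "\<Sum>(insert p (insert q (C - {d}))) = p + (q + \<Sum>(C - {d}))"
      using C' notin by simp
    also have "\<dots> = d + \<Sum>(C - {d})" using d by simp
    also have "\<dots> = e" using C' d(1) by (metis sum.remove)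
    finally show ?thesis .
  qed
  ultimately have "eigen_system x (insert p (insert q (C - {d})))"
    using C' p q pq qp orth unfolding eigen_system_def by auto
  moreover have "card C < card (insert p (insert q (C - {d})))"
    using C' notin d(1) by (simp add: card_Suc_Diff1)
  ultimately show ?thesis by blast
qed

lemma spectral_frame: "\<exists>C. jordan_frame jp e C \<and> (\<forall>c\<in>C. \<exists>\<mu>. jp x c = \<mu> *\<^sub>R c)"
proof -
  obtain C where C: "eigen_system x C" "\<And>D. eigen_system x D \<Longrightarrow> card D \<le> card C"
    using ex_has_greatest_nat[of "eigen_system x" _ card "Suc DIM('v)"] eigen_system_exists[of x]
      eigen_system_card[of x] by (metis le_imp_less_Suc)
  have prim: "primitive_idempotent jp c" if c: "c \<in> C" for c
    unfolding primitive_idempotent_def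
  proof (intro conjI notI)
    show "c = 0 \<Longrightarrow> False" "jp c c = c" using C(1) c unfolding eigen_system_def by auto
    assume "\<exists>p q. p \<noteq> 0 \<and> jp p p = p \<and> q \<noteq> 0 \<and> jp q q = q \<and> c = p + q"
    then obtain C' where "eigen_system x C'" "card C < card C'"
      using eigen_system_split[OF C(1) c] by blast
    then show False using C(2) by (simp add: not_less[symmetric])
  qed
  show ?thesis using C(1) prim unfolding eigen_system_def jordan_frame_def by blast
qed

section \<open>Overlaps of two frames and invariance of the rank\<close>

lemma primitive_inner_div:
  assumes "primitive_idempotent jp c" "primitive_idempotent jp d"
  shows "c \<bullet> d / (c \<bullet> c) = d \<bullet> c / (d \<bullet> d)"
  using primitive_nonorthogonal_norm[OF assms] by (cases "c \<bullet> d = 0") (auto simp: inner_commute)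

lemma frame_row_sum:
  assumes "primitive_idempotent jp c" "jordan_frame jp e D"
  shows "(\<Sum>d\<in>D. c \<bullet> d / (c \<bullet> c)) = 1"
proof -
  have "(\<Sum>d\<in>D. c \<bullet> d) = c \<bullet> e"
    using assms(2) by (simp add: jordan_frame_def flip: inner_sum_right)
  also have "\<dots> = c \<bullet> c"
    using jp_inner_unit[of c c] primitive_idempotentD(2)[OF assms(1)] by simp
  finally show ?thesis
    using primitive_idempotentD(3)[OF assms(1)] by (simp flip: sum_divide_distrib)
qed

text \<open>Both cardinalities are the total of one matrix whose rows and columns each sum to
  1.\<close>

lemma jordan_frame_card_eq:
  assumes C: "jordan_frame jp e C" and D: "jordan_frame jp e D"
  shows "card C = card D"
proof -
  have prim: "primitive_idempotent jp c" "primitive_idempotent jp d" if "c \<in> C" "d \<in> D" for c d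
    using that C D by (auto simp: jordan_frame_def)
  have "real (card C) = (\<Sum>c\<in>C. \<Sum>d\<in>D. c \<bullet> d / (c \<bullet> c))"
    using frame_row_sum[OF _ D] C by (simp add: jordan_frame_def)
  also have "\<dots> = (\<Sum>d\<in>D. \<Sum>c\<in>C. d \<bullet> c / (d \<bullet> d))"
    using primitive_inner_div prim by (subst sum.swap) (intro sum.cong, auto)
  also have "\<dots> = real (card D)"
    using frame_row_sum[OF _ C] D by (simp add: jordan_frame_def)
  finally show ?thesis by simp
qed

end

lemma sorting_bijection:
  fixes h :: "'a \<Rightarrow> real"
  assumes "finite C" "card C = CARD('n::{finite,linorder})"
  obtains c :: "'n::{finite,linorder} \<Rightarrow> 'a" where "bij_betw c UNIV C" "\<And>i j. i \<le> j \<Longrightarrow> h (c j) \<le> h (c i)"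
proof -
  obtain xs where xs: "set xs = C" "distinct xs" using finite_distinct_list assms(1) by blast
  define ys where "ys = sort_key (\<lambda>a. - h a) xs"
  have ys: "set ys = C" "distinct ys" "sorted (map (\<lambda>a. - h a) ys)"
    using xs unfolding ys_def by auto
  have len: "length ys = CARD('n)" using ys assms distinct_card by metis
  \<comment> \<open>The position of \<open>i\<close> counted from 0: an order isomorphism onto the
    list indices.\<close>
  define r where "r = (\<lambda>i::'n. card {..<i})"
  have mono: "r i < r j" if "i < j" for i j
    unfolding r_def using that by (intro psubset_card_mono) auto
  have "inj r" using mono by (metis injI less_irrefl linorder_less_linear)
  have lt: "r i < CARD('n)" for i unfolding r_def by (intro psubset_card_mono) auto
  then have "range r = {..<CARD('n)}"
    using \<open>inj r\<close> by (intro card_subset_eq) (auto simp: card_image)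
  then have "bij_betw r UNIV {..<length ys}" using \<open>inj r\<close> len by (simp add: bij_betw_def)
  moreover have "bij_betw ((!) ys) {..<length ys} C" using ys by (intro bij_betw_nth) auto
  ultimately have "bij_betw ((!) ys \<circ> r) UNIV C" by (rule bij_betw_trans)
  moreover have "h (((!) ys \<circ> r) j) \<le> h (((!) ys \<circ> r) i)" if "i \<le> j" for i j
  proof -
    have "r i \<le> r j" using that mono by (metis le_less)
    then show ?thesis using sorted_nth_mono[OF ys(3), of "r i" "r j"] lt len by simp
  qed
  ultimately show ?thesis using that by blast
qed

section \<open>Rearrangements and majorization\<close>

text \<open>Covers \<open>{..k}\<close>, \<open>{..<k}\<close>, the whole type and the empty set at
  once, so that single entries are differences of sums over two initial segments.\<close>

definition initial_segment :: "'n::linorder set \<Rightarrow> bool" where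
  "initial_segment I \<longleftrightarrow> (\<forall>i\<in>I. \<forall>j\<le>i. j \<in> I)"

lemma initial_segment_simps [simp]:
  "initial_segment {..k}" "initial_segment {..<k}" "initial_segment UNIV"
  by (auto simp: initial_segment_def)

lemma vec_eq_initial_sums:
  fixes u v :: "real ^ 'n::{finite,linorder}"
  assumes "\<And>I. initial_segment I \<Longrightarrow> (\<Sum>i\<in>I. u $ i) = (\<Sum>i\<in>I. v $ i)"
  shows "u = v"
proof -
  have "u $ k = v $ k" for k
  proof -
    have "{..k} = insert k {..<k}" by auto
    then have "(\<Sum>i\<in>{..k}. h i) = h k + (\<Sum>i\<in>{..<k}. h i)" for h :: "'n \<Rightarrow> real" by simp
    then show ?thesis using assms[of "{..k}"] assms[of "{..<k}"] by simp
  qed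
  then show ?thesis by (simp add: vec_eq_iff)
qed

text \<open>Measure \<open>v\<close> from a threshold \<open>t\<close> separating its values on
  \<open>I\<close> from those off \<open>I\<close>: this costs nothing because the weights have
  total \<open>card I\<close>, and every term then has the right sign.\<close>

lemma weighted_sum_le_initial_sum:
  fixes v :: "real ^ 'n::{finite,linorder}"
  assumes v: "nonincreasing v" and I: "initial_segment I"
    and m: "\<And>i. 0 \<le> m i" "\<And>i. m i \<le> 1" "(\<Sum>i\<in>UNIV. m i) = real (card I)"
  shows "(\<Sum>i\<in>UNIV. m i * v $ i) \<le> (\<Sum>i\<in>I. v $ i)"
proof -
  \<comment> \<open>The smallest value on \<open>I\<close>; for empty \<open>I\<close> the largest
    entry, so that \<open>out_I\<close> still holds.\<close>
  define t where "t = (if I = {} then v $ Min UNIV else v $ Max I)"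
  have in_I: "t \<le> v $ i" if "i \<in> I" for i
    using that v unfolding t_def nonincreasing_def by auto
  have out_I: "v $ i \<le> t" if "i \<notin> I" for i
  proof (cases "I = {}")
    case False
    then have "\<not> i \<le> Max I" using I that unfolding initial_segment_def by (metis Max_in finite)
    then show ?thesis using v False unfolding t_def nonincreasing_def by auto
  qed (use v in \<open>simp add: t_def nonincreasing_def\<close>)
  have "(\<Sum>i\<in>UNIV. (m i - of_bool (i \<in> I)) * (v $ i - t)) \<le> 0"
    using in_I out_I m(1,2)
    by (intro sum_nonpos) (auto simp: mult_nonpos_nonneg mult_nonneg_nonpos)
  moreover have "(\<Sum>i\<in>UNIV. (m i - of_bool (i \<in> I)) * (v $ i - t))
      = (\<Sum>i\<in>UNIV. m i * v $ i) - (\<Sum>i\<in>UNIV. of_bool (i \<in> I) * v $ i)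
        - t * ((\<Sum>i\<in>UNIV. m i) - (\<Sum>i\<in>UNIV. of_bool (i \<in> I)))"
    by (simp add: algebra_simps sum.distrib sum_subtractf sum_distrib_left)
  moreover have "(\<Sum>i\<in>UNIV. of_bool (i \<in> I) * v $ i) = (\<Sum>i\<in>I. v $ i)"
    by (simp add: of_bool_def if_distrib if_distribR sum.If_cases)
  moreover have "(\<Sum>i\<in>UNIV. of_bool (i \<in> I)) = real (card I)" by simp
  ultimately show ?thesis using m(3) by simp
qed

lemma sum_le_initial_sum:
  fixes v :: "real ^ 'n::{finite,linorder}"
  assumes "nonincreasing v" "initial_segment I" "card J = card I"
  shows "(\<Sum>i\<in>J. v $ i) \<le> (\<Sum>i\<in>I. v $ i)"
proof -
  have "(\<Sum>i\<in>UNIV. of_bool (i \<in> J) * v $ i) \<le> (\<Sum>i\<in>I. v $ i)"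
    using assms by (intro weighted_sum_le_initial_sum) auto
  then show ?thesis by (simp add: of_bool_def if_distrib if_distribR sum.If_cases)
qed

lemma permuted_initial_sum_le:
  fixes u v :: "real ^ 'n::{finite,linorder}"
  assumes "nonincreasing v" "initial_segment I" "bij p" "v = permute_coords p u" "bij q"
  shows "(\<Sum>i\<in>I. permute_coords q u $ i) \<le> (\<Sum>i\<in>I. v $ i)"
proof -
  have inj: "inj_on (inv p \<circ> q) I"
    using assms(3,5) by (metis bij_comp bij_imp_bij_inv bij_is_inj inj_on_subset subset_UNIV)
  have "(\<Sum>i\<in>I. permute_coords q u $ i) = (\<Sum>i\<in>I. v $ ((inv p \<circ> q) i))"
    using assms(3,4) by (simp add: permute_coords_def bij_is_surj surj_f_inv_f)
  also have "\<dots> = (\<Sum>i\<in>(inv p \<circ> q) ` I. v $ i)" 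
    using sum.reindex[OF inj, of "($) v"] by (simp add: o_def)
  also have "\<dots> \<le> (\<Sum>i\<in>I. v $ i)"
    using assms card_image[OF inj] by (intro sum_le_initial_sum) auto
  finally show ?thesis .
qed

text \<open>Two nonincreasing rearrangements dominate each other's initial sums, so the description
  by \<open>THE\<close> is definite.\<close>

lemma decreasing_rearrangement_eqI:
  fixes u v :: "real ^ 'n::{finite,linorder}"
  assumes "nonincreasing v" "bij p" "v = permute_coords p u"
  shows "decreasing_rearrangement u = v"
  unfolding decreasing_rearrangement_def
proof (rule the_equality)
  show "nonincreasing v \<and> (\<exists>p. bij p \<and> v = permute_coords p u)" using assms by blast
  fix w assume "nonincreasing w \<and> (\<exists>p. bij p \<and> w = permute_coords p u)"
  then obtain q where q: "nonincreasing w" "bij q" "w = permute_coords q u" by blast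
  show "w = v"
    using permuted_initial_sum_le[OF assms(1) _ assms(2,3) q(2)]
      permuted_initial_sum_le[OF q(1) _ q(2,3) assms(2)] q(3) assms(3)
    by (intro vec_eq_initial_sums) (metis order_antisym)
qed

lemma decreasing_rearrangement_obtain:
  fixes u :: "real ^ 'n::{finite,linorder}"
  obtains p where "bij p" "decreasing_rearrangement u = permute_coords p u"
    "nonincreasing (decreasing_rearrangement u)"
proof -
  obtain p :: "'n \<Rightarrow> 'n" where "bij p" "\<And>i j. i \<le> j \<Longrightarrow> u $ p j \<le> u $ p i"
    using sorting_bijection[of "UNIV :: 'n set" "\<lambda>i. u $ i"] by auto
  moreover from this have "nonincreasing (permute_coords p u)"
    by (simp add: nonincreasing_def permute_coords_def)
  ultimately show ?thesis using that decreasing_rearrangement_eqI by metis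
qed

lemma decreasing_rearrangement_nonincreasing:
  assumes "nonincreasing u"
  shows "decreasing_rearrangement u = u"
  using assms by (intro decreasing_rearrangement_eqI[of _ id]) (auto simp: permute_coords_def)

lemma majorized_nonincreasingI:
  fixes u v :: "real ^ 'n::{finite,linorder}"
  assumes v: "nonincreasing v"
    and le: "\<And>I J. initial_segment I \<Longrightarrow> card J = card I \<Longrightarrow> (\<Sum>i\<in>J. u $ i) \<le> (\<Sum>i\<in>I. v $ i)"
    and eq: "(\<Sum>i\<in>UNIV. u $ i) = (\<Sum>i\<in>UNIV. v $ i)"
  shows "majorized u v"
proof -
  obtain p where p: "bij p" "decreasing_rearrangement u = permute_coords p u"
    by (rule decreasing_rearrangement_obtain)
  have sums: "(\<Sum>i\<in>I. decreasing_rearrangement u $ i) = (\<Sum>i\<in>p ` I. u $ i)" for I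
    using p bij_is_inj[OF p(1)] by (simp add: permute_coords_def sum.reindex inj_on_subset)
  have "card (p ` I) = card I" for I
    using bij_is_inj[OF p(1)] by (simp add: card_image inj_on_subset)
  then show ?thesis
    unfolding majorized_def decreasing_rearrangement_nonincreasing[OF v] sums
    using le eq bij_is_surj[OF p(1)] by simp
qed

text \<open>Abel summation, run as an induction that adds the largest index and carries a lower
  bound \<open>t\<close> of \<open>v\<close>.\<close>

lemma inner_nonneg_of_initial_sums:
  fixes v d :: "real ^ 'n::{finite,linorder}"
  assumes v: "nonincreasing v"
    and d: "\<And>I. initial_segment I \<Longrightarrow> 0 \<le> (\<Sum>i\<in>I. d $ i)" and d0: "(\<Sum>i\<in>UNIV. d $ i) = 0"
  shows "0 \<le> v \<bullet> d"
proof -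
  have "t * (\<Sum>i\<in>A. d $ i) \<le> (\<Sum>i\<in>A. v $ i * d $ i)"
    if "finite A" "initial_segment A" "\<forall>i\<in>A. t \<le> v $ i" for A t
    using that
  proof (induction A arbitrary: t rule: finite_linorder_max_induct)
    case (insert b A)
    have A: "initial_segment A"
      using insert.prems(1) insert.hyps(2) unfolding initial_segment_def
      by (metis insert_iff le_less_trans less_irrefl)
    have b: "b \<notin> A" using insert.hyps(2) by blast
    have "t * (\<Sum>i\<in>insert b A. d $ i) \<le> v $ b * (\<Sum>i\<in>insert b A. d $ i)"
      using insert.prems d[OF insert.prems(1)] by (intro mult_right_mono) auto
    also have "\<dots> = v $ b * (\<Sum>i\<in>A. d $ i) + v $ b * d $ b"
      using insert.hyps(1) b by (simp add: algebra_simps)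
    also have "v $ b * (\<Sum>i\<in>A. d $ i) \<le> (\<Sum>i\<in>A. v $ i * d $ i)"
      using A insert.hyps(2) v by (intro insert.IH) (auto simp: nonincreasing_def)
    finally show ?case using insert.hyps(1) b by (simp add: add.commute)
  qed simp
  \<comment> \<open>Any lower bound of \<open>v\<close> serves, since it multiplies the zero total
    of \<open>d\<close>.\<close>
  from this[of UNIV "Min (range (($) v))"] show ?thesis
    by (simp add: d0 inner_vec_def)
qed

text \<open>Abel summation gives \<open>u \<bullet> (v - u) \<ge> 0\<close>, so
  \<open>v \<bullet> v\<close> exceeds \<open>u \<bullet> u\<close> by at least the squared length
  of \<open>v - u\<close>.\<close>

lemma majorized_norm_eq:
  fixes u v :: "real ^ 'n::{finite,linorder}"
  assumes u: "nonincreasing u"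
    and le: "\<And>I. initial_segment I \<Longrightarrow> (\<Sum>i\<in>I. u $ i) \<le> (\<Sum>i\<in>I. v $ i)"
    and eq: "(\<Sum>i\<in>UNIV. u $ i) = (\<Sum>i\<in>UNIV. v $ i)"
    and n: "v \<bullet> v \<le> u \<bullet> u"
  shows "u = v"
proof -
  have "0 \<le> u \<bullet> (v - u)"
    using le eq by (intro inner_nonneg_of_initial_sums[OF u]) (auto simp: sum_subtractf)
  moreover have "(v - u) \<bullet> (v - u) = v \<bullet> v - u \<bullet> u - 2 * (u \<bullet> (v - u))"
    by (simp add: inner_diff_left inner_diff_right inner_commute[of v u])
  ultimately have "(v - u) \<bullet> (v - u) \<le> 0" using n by linarith
  then show ?thesis by (metis inner_ge_zero inner_eq_zero_iff order_antisym right_minus_eq)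
qed

section \<open>Eigenvalues of sums and differences\<close>

locale ranked_euclidean_jordan_algebra = euclidean_jordan_algebra jp e
  for jp :: "'v::euclidean_space \<Rightarrow> 'v \<Rightarrow> 'v" and e :: 'v +
  fixes N :: "'n::{finite,linorder} itself"
  assumes rank: "has_rank jp e CARD('n)"
begin

abbreviation eig :: "'v \<Rightarrow> (real, 'n) vec" where
  "eig \<equiv> eigenvalues jp e"

abbreviation frame :: "('n \<Rightarrow> 'v) \<Rightarrow> bool" where
  "frame \<equiv> indexed_jordan_frame jp e"

definition combine :: "(real, 'n) vec \<Rightarrow> ('n \<Rightarrow> 'v) \<Rightarrow> 'v" where
  "combine l c = (\<Sum>i\<in>UNIV. (l $ i) *\<^sub>R c i)"

text \<open>The coordinate of \<open>x\<close> along \<open>c\<close>; for primitive \<open>c\<close> it is the trace inner product of the two.\<close>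

definition coord :: "'v \<Rightarrow> 'v \<Rightarrow> real" where
  "coord c x = c \<bullet> x / (c \<bullet> c)"

lemma coord_linear:
  "coord c (x + y) = coord c x + coord c y" "coord c (x - y) = coord c x - coord c y"
  "coord c (t *\<^sub>R x) = t * coord c x" "coord c (\<Sum>i\<in>A. g i) = (\<Sum>i\<in>A. coord c (g i))"
  by (simp_all add: coord_def inner_add_right inner_diff_right inner_sum_right add_divide_distrib
      diff_divide_distrib sum_divide_distrib)

lemma frameD:
  assumes "frame c"
  shows "inj c" "primitive_idempotent jp (c i)" "jordan_frame jp e (range c)"
    "i \<noteq> j \<Longrightarrow> jp (c i) (c j) = 0" "(\<Sum>i\<in>UNIV. c i) = e"
  using assms unfolding indexed_jordan_frame_def jordan_frame_def
  by (auto simp: inj_eq sum.reindex)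

lemma frame_permute:
  assumes "frame c" "bij p"
  shows "frame (c \<circ> p)"
proof -
  have "range (c \<circ> p) = range c" using bij_is_surj[OF assms(2)] by (metis image_comp)
  then show ?thesis
    using assms unfolding indexed_jordan_frame_def by (metis bij_is_inj inj_compose)
qed

lemma jp_combine:
  assumes "frame c"
  shows "jp (c i) (combine l c) = l $ i *\<^sub>R c i"
proof -
  have "jp (c i) (combine l c) = (\<Sum>j\<in>UNIV. l $ j *\<^sub>R jp (c i) (c j))"
    by (simp add: combine_def jp_sum_right jp_scaleR_right)
  also have "\<dots> = l $ i *\<^sub>R jp (c i) (c i)"
    using frameD(4)[OF assms] by (subst sum.remove[of _ i]) auto
  finally show ?thesis using primitive_idempotentD(2)[OF frameD(2)[OF assms]] by simp
qed

lemma coord_combine_self: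
  assumes "frame c"
  shows "coord (c i) (combine l c) = l $ i"
proof -
  note ci = frameD(2)[OF assms, of i]
  have "c i \<bullet> combine l c = c i \<bullet> jp (c i) (combine l c)"
    by (metis ci jp_self_adjoint primitive_idempotentD(2))
  then show ?thesis
    using primitive_idempotentD(3)[OF ci] by (simp add: coord_def jp_combine[OF assms])
qed

lemma coord_nonneg:
  assumes "primitive_idempotent jp c" "primitive_idempotent jp d"
  shows "0 \<le> coord c d"
  using idempotent_inner_nonneg primitive_idempotentD(2) assms by (simp add: coord_def)

lemma coord_sym:
  assumes "primitive_idempotent jp c" "primitive_idempotent jp d"
  shows "coord c d = coord d c"
  using primitive_inner_div[OF assms] by (simp add: coord_def)

lemma coord_row_sum:
  assumes "primitive_idempotent jp c" "frame d"
  shows "(\<Sum>j\<in>UNIV. coord c (d j)) = 1"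
  using frame_row_sum[OF assms(1) frameD(3)[OF assms(2)]] frameD(1)[OF assms(2)]
  by (simp add: coord_def sum.reindex)

lemma coord_col_sum:
  assumes "primitive_idempotent jp d" "frame c"
  shows "(\<Sum>i\<in>UNIV. coord (c i) d) = 1"
  using coord_row_sum[OF assms] coord_sym[OF assms(1) frameD(2)[OF assms(2)]] by simp

lemma coord_combine: "coord c (combine l d) = (\<Sum>j\<in>UNIV. l $ j * coord c (d j))"
  by (simp add: combine_def coord_linear)

text \<open>The Ky Fan inequality: the partial column sums over \<open>J\<close> are weights in
  [0, 1] with total \<open>card J\<close>.\<close>

lemma coord_sum_le:
  assumes c: "frame c" and d: "frame d" and l: "nonincreasing l"
    and I: "initial_segment I" "card J = card I"
  shows "(\<Sum>i\<in>J. coord (c i) (combine l d)) \<le> (\<Sum>i\<in>I. l $ i)"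
proof -
  note prim = frameD(2)[OF c] frameD(2)[OF d]
  have "(\<Sum>i\<in>J. coord (c i) (combine l d)) = (\<Sum>j\<in>UNIV. (\<Sum>i\<in>J. coord (c i) (d j)) * l $ j)"
    unfolding coord_combine by (subst sum.swap) (simp add: sum_distrib_left mult.commute)
  also have "\<dots> \<le> (\<Sum>i\<in>I. l $ i)"
  proof (rule weighted_sum_le_initial_sum[OF l I(1)])
    show "0 \<le> (\<Sum>i\<in>J. coord (c i) (d j))" for j
      using coord_nonneg prim by (intro sum_nonneg) auto
    have "(\<Sum>i\<in>J. coord (c i) (d j)) \<le> (\<Sum>i\<in>UNIV. coord (c i) (d j))" for j
      using coord_nonneg prim by (intro sum_mono2) auto
    then show "(\<Sum>i\<in>J. coord (c i) (d j)) \<le> 1" for j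
      using coord_col_sum[OF prim(2) c] by simp
    show "(\<Sum>j\<in>UNIV. \<Sum>i\<in>J. coord (c i) (d j)) = real (card I)"
      using coord_row_sum[OF prim(1) d] I(2) by (subst sum.swap) simp
  qed
  finally show ?thesis .
qed

text \<open>Each coefficient vector is the diagonal of the other decomposition, so the Ky Fan
  inequality holds both ways.\<close>

lemma combine_unique:
  assumes "frame c" "frame d" "nonincreasing l" "nonincreasing m" "combine l c = combine m d"
  shows "l = m"
proof (rule vec_eq_initial_sums)
  fix I :: "'n set" assume I: "initial_segment I"
  have "(\<Sum>i\<in>I. l $ i) = (\<Sum>i\<in>I. coord (c i) (combine m d))"
    using assms(5) coord_combine_self[OF assms(1), of _ l] by simp
  moreover have "(\<Sum>i\<in>I. m $ i) = (\<Sum>i\<in>I. coord (d i) (combine l c))"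
    using assms(5) coord_combine_self[OF assms(2), of _ m] by simp
  ultimately show "(\<Sum>i\<in>I. l $ i) = (\<Sum>i\<in>I. m $ i)"
    using coord_sum_le[OF assms(1,2,4) I refl] coord_sum_le[OF assms(2,1,3) I refl] by linarith
qed

lemma eigenvalues_combine:
  assumes "frame c" "nonincreasing l"
  shows "eig (combine l c) = l"
  unfolding eigenvalues_def
proof (rule the_equality)
  show "nonincreasing l \<and> (\<exists>d. frame d \<and> combine l c = (\<Sum>i\<in>UNIV. (l $ i) *\<^sub>R d i))"
    using assms by (auto simp: combine_def)
  show "m = l" if "nonincreasing m \<and> (\<exists>d. frame d \<and> combine l c = (\<Sum>i\<in>UNIV. (m $ i) *\<^sub>R d i))" for m
    using that combine_unique assms by (metis combine_def)
qed

lemma spectral_decomposition: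
  "\<exists>c. frame c \<and> x = combine (eig x) c" "nonincreasing (eig x)"
proof -
  obtain C where C: "jordan_frame jp e C" "\<forall>c\<in>C. \<exists>\<mu>. jp x c = \<mu> *\<^sub>R c"
    using spectral_frame by blast
  then obtain \<mu> where \<mu>: "\<And>c. c \<in> C \<Longrightarrow> jp x c = \<mu> c *\<^sub>R c" by metis
  have "card C = CARD('n)"
    using rank C(1) jordan_frame_card_eq unfolding has_rank_def by metis
  then obtain c :: "'n \<Rightarrow> 'v" where c: "bij_betw c UNIV C" "\<And>i j. i \<le> j \<Longrightarrow> \<mu> (c j) \<le> \<mu> (c i)"
    using sorting_bijection[of C \<mu>] C(1) unfolding jordan_frame_def by blast
  then have f: "frame c" using C(1) by (auto simp: indexed_jordan_frame_def bij_betw_def)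
  define l :: "(real, 'n) vec" where "l = (\<chi> i. \<mu> (c i))"
  have l: "nonincreasing l" using c(2) by (simp add: nonincreasing_def l_def)
  have cC: "c i \<in> C" for i using c(1) by (auto simp: bij_betw_def)
  have "x = jp x (\<Sum>i\<in>UNIV. c i)" using frameD(5)[OF f] jp_unit by simp
  also have "\<dots> = combine l c" by (simp add: jp_sum_right combine_def l_def \<mu>[OF cC])
  finally have "x = combine l c" .
  moreover from this have "eig x = l" using eigenvalues_combine[OF f l] by simp
  ultimately show "\<exists>c. frame c \<and> x = combine (eig x) c" "nonincreasing (eig x)"
    using f l by auto
qed

lemma eigenvalues_combine_rearranged:
  assumes "frame c"
  shows "eig (combine u c) = decreasing_rearrangement u"
proof -
  obtain p where p: "bij p" "decreasing_rearrangement u = permute_coords p u"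
    "nonincreasing (decreasing_rearrangement u)"
    by (rule decreasing_rearrangement_obtain)
  have "combine u c = combine (permute_coords p u) (c \<circ> p)"
    unfolding combine_def permute_coords_def
    using sum.reindex_bij_betw[OF p(1), of "\<lambda>i. u $ i *\<^sub>R c i"] by simp
  then show ?thesis
    using eigenvalues_combine[OF frame_permute[OF assms p(1)], of "permute_coords p u"] p by simp
qed

lemma coord_sum_le_eigenvalues:
  assumes "frame c" "initial_segment I" "card J = card I"
  shows "(\<Sum>i\<in>J. coord (c i) x) \<le> (\<Sum>i\<in>I. eig x $ i)"
  using coord_sum_le[OF assms(1) _ _ assms(2,3)] spectral_decomposition[of x] by metis

lemma coord_sum_UNIV:
  assumes "frame c"
  shows "(\<Sum>i\<in>UNIV. coord (c i) x) = (\<Sum>i\<in>UNIV. eig x $ i)"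
proof -
  obtain d where d: "frame d" "x = combine (eig x) d" using spectral_decomposition by blast
  have "(\<Sum>i\<in>UNIV. coord (c i) x) = (\<Sum>i\<in>UNIV. \<Sum>j\<in>UNIV. eig x $ j * coord (c i) (d j))"
    by (subst d(2)) (simp add: coord_combine)
  also have "\<dots> = (\<Sum>j\<in>UNIV. eig x $ j * (\<Sum>i\<in>UNIV. coord (c i) (d j)))"
    by (subst sum.swap) (simp add: sum_distrib_left)
  also have "\<dots> = (\<Sum>i\<in>UNIV. eig x $ i)"
    using coord_col_sum[OF frameD(2)[OF d(1)] assms] by simp
  finally show ?thesis .
qed

lemma eigenvalues_coord:
  assumes "frame c" "x = combine (eig x) c"
  shows "coord (c i) x = eig x $ i"
  using coord_combine_self[OF assms(1), of i "eig x"] assms(2) by simp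

lemma trace_add: "(\<Sum>i\<in>UNIV. eig (x + y) $ i) = (\<Sum>i\<in>UNIV. eig x $ i) + (\<Sum>i\<in>UNIV. eig y $ i)"
proof -
  obtain c where c: "frame c" using spectral_decomposition by blast
  show ?thesis unfolding coord_sum_UNIV[OF c, symmetric] by (simp add: coord_linear sum.distrib)
qed

text \<open>Read the diagonals of both summands in a frame of the sum.\<close>

lemma eigenvalues_add_sum_le:
  assumes "initial_segment I"
  shows "(\<Sum>i\<in>I. eig (x + y) $ i) \<le> (\<Sum>i\<in>I. (eig x + eig y) $ i)"
proof -
  obtain c where c: "frame c" "x + y = combine (eig (x + y)) c" using spectral_decomposition by blast
  have "(\<Sum>i\<in>I. eig (x + y) $ i) = (\<Sum>i\<in>I. coord (c i) x) + (\<Sum>i\<in>I. coord (c i) y)"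
    using eigenvalues_coord[OF c] by (simp add: coord_linear flip: sum.distrib)
  then show ?thesis
    using coord_sum_le_eigenvalues[OF c(1) assms refl, of x]
      coord_sum_le_eigenvalues[OF c(1) assms refl, of y] by (simp add: sum.distrib)
qed

lemma eigenvalues_add_majorized: "majorized (eig (x + y)) (eig x + eig y)"
proof (rule majorized_nonincreasingI)
  show n: "nonincreasing (eig x + eig y)"
    using spectral_decomposition(2)[of x] spectral_decomposition(2)[of y]
    by (simp add: nonincreasing_def add_mono)
  show "(\<Sum>i\<in>UNIV. eig (x + y) $ i) = (\<Sum>i\<in>UNIV. (eig x + eig y) $ i)"
    by (simp add: trace_add sum.distrib)
  fix I J :: "'n set" assume IJ: "initial_segment I" "card J = card I"
  show "(\<Sum>i\<in>J. eig (x + y) $ i) \<le> (\<Sum>i\<in>I. (eig x + eig y) $ i)"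
    using sum_le_initial_sum[OF spectral_decomposition(2) IJ] eigenvalues_add_sum_le[OF IJ(1)]
    by (rule order_trans)
qed

text \<open>Equality of the diagonal with the spectrum forces the frames to match up, since then
  \<open>\<Sum>i j. coord (c i) (d j) (l i - l j)\<^sup>2 = 0\<close>.\<close>

lemma combine_of_coord_eq:
  assumes c: "frame c" and eq: "\<And>i. coord (c i) x = eig x $ i"
  shows "x = combine (eig x) c"
proof -
  obtain d where d: "frame d" "x = combine (eig x) d" using spectral_decomposition by blast
  define l where "l = eig x"
  define m where "m = (\<lambda>i j. coord (c i) (d j))"
  note prim = frameD(2)[OF c] frameD(2)[OF d(1)]
  have m0: "0 \<le> m i j" for i j using coord_nonneg prim by (simp add: m_def)
  have row: "(\<Sum>j\<in>UNIV. m i j) = 1" for i using coord_row_sum[OF prim(1) d(1)] by (simp add: m_def)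
  have col: "(\<Sum>i\<in>UNIV. m i j) = 1" for j using coord_col_sum[OF prim(2) c] by (simp add: m_def)
  have diag: "(\<Sum>j\<in>UNIV. l $ j * m i j) = l $ i" for i
    using eq[of i] coord_combine[of "c i" "eig x" d] d(2) by (simp add: l_def m_def)
  \<comment> \<open>Unit row and column sums and the diagonal condition turn the three terms into
    \<open>l \<bullet> l + l \<bullet> l - 2 * (l \<bullet> l)\<close>.\<close>
  have "(\<Sum>i\<in>UNIV. \<Sum>j\<in>UNIV. m i j * (l $ i - l $ j)\<^sup>2)
      = (\<Sum>i\<in>UNIV. (l $ i)\<^sup>2 * (\<Sum>j\<in>UNIV. m i j)) + (\<Sum>i\<in>UNIV. \<Sum>j\<in>UNIV. (l $ j)\<^sup>2 * m i j)
        - 2 * (\<Sum>i\<in>UNIV. l $ i * (\<Sum>j\<in>UNIV. l $ j * m i j))"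
    by (simp add: power2_eq_square algebra_simps sum.distrib sum_subtractf sum_distrib_left)
  also have "(\<Sum>i\<in>UNIV. \<Sum>j\<in>UNIV. (l $ j)\<^sup>2 * m i j) = (\<Sum>j\<in>UNIV. (l $ j)\<^sup>2 * (\<Sum>i\<in>UNIV. m i j))"
    by (subst sum.swap) (simp add: sum_distrib_left)
  finally have "(\<Sum>i\<in>UNIV. \<Sum>j\<in>UNIV. m i j * (l $ i - l $ j)\<^sup>2) = 0"
    unfolding row col diag by (simp add: power2_eq_square)
  then have "m i j * (l $ i - l $ j)\<^sup>2 = 0" for i j
    using m0 by (simp add: sum_nonneg_eq_0_iff sum_nonneg)
  then have z: "l $ i = l $ j \<or> jp (c i) (d j) = 0" for i j
    using prim[THEN primitive_idempotentD(2)] prim(1)[THEN primitive_idempotentD(3), of i]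
      idempotent_orthogonal[of "c i" "d j"]
    by (auto simp: m_def coord_def)
  have "jp (c i) x = l $ i *\<^sub>R c i" for i
  proof -
    have "jp (c i) x = (\<Sum>j\<in>UNIV. l $ j *\<^sub>R jp (c i) (d j))"
      by (subst d(2)) (simp add: combine_def jp_sum_right jp_scaleR_right l_def)
    also have "\<dots> = (\<Sum>j\<in>UNIV. l $ i *\<^sub>R jp (c i) (d j))"
      using z by (intro sum.cong) (metis scaleR_zero_right)+
    also have "\<dots> = l $ i *\<^sub>R jp (c i) (\<Sum>j\<in>UNIV. d j)"
      by (simp add: jp_sum_right scaleR_sum_right)
    finally show ?thesis using frameD(5)[OF d(1)] jp_unit by simp
  qed
  then have "combine l c = jp (\<Sum>i\<in>UNIV. c i) x" by (simp add: combine_def jp_sum_left)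
  then show ?thesis using frameD(5)[OF c] jp_unit_left by (simp add: l_def)
qed

text \<open>In a frame of \<open>x + y\<close> two Ky Fan inequalities add up to an equality, so
  each is tight and both diagonals are spectra.\<close>

lemma strongly_operator_commute_of_add:
  assumes "eig (x + y) = eig x + eig y"
  shows "strongly_operator_commute TYPE('n) jp e x y"
proof -
  obtain c where c: "frame c" "x + y = combine (eig (x + y)) c" using spectral_decomposition by blast
  have sums: "(\<Sum>i\<in>I. coord (c i) x) = (\<Sum>i\<in>I. eig x $ i)
      \<and> (\<Sum>i\<in>I. coord (c i) y) = (\<Sum>i\<in>I. eig y $ i)" if I: "initial_segment I" for I
  proof -
    have "(\<Sum>i\<in>I. coord (c i) x) + (\<Sum>i\<in>I. coord (c i) y) = (\<Sum>i\<in>I. eig x $ i) + (\<Sum>i\<in>I. eig y $ i)"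
      using eigenvalues_coord[OF c] assms by (simp add: coord_linear flip: sum.distrib)
    then show ?thesis
      using coord_sum_le_eigenvalues[OF c(1) I refl, of x]
        coord_sum_le_eigenvalues[OF c(1) I refl, of y] by linarith
  qed
  have "(\<chi> i. coord (c i) x) = eig x" "(\<chi> i. coord (c i) y) = eig y"
    using sums by (auto intro!: vec_eq_initial_sums)
  then have "x = combine (eig x) c" "y = combine (eig y) c"
    by (auto intro!: combine_of_coord_eq[OF c(1)] simp: vec_eq_iff)
  then show ?thesis using c(1) unfolding strongly_operator_commute_def combine_def by blast
qed

section \<open>The trace form\<close>

lemma coord_swap:
  assumes "frame c" "frame d"
  shows "(\<Sum>i\<in>UNIV. l $ i * coord (c i) (combine m d)) = (\<Sum>j\<in>UNIV. m $ j * coord (d j) (combine l c))"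
  unfolding coord_combine sum_distrib_left
  by (subst sum.swap) (simp add: coord_sym[OF frameD(2)[OF assms(1)] frameD(2)[OF assms(2)]] mult.left_commute)

definition eigenframe :: "'v \<Rightarrow> 'n \<Rightarrow> 'v" where
  "eigenframe x = (SOME c. frame c \<and> x = combine (eig x) c)"

lemma eigenframe: "frame (eigenframe x)" "x = combine (eig x) (eigenframe x)"
  using someI_ex[OF spectral_decomposition(1)[of x]] unfolding eigenframe_def by auto

text \<open>The trace of \<open>jp x y\<close>, written so that linearity in \<open>y\<close> is
  visible; linearity in \<open>x\<close> comes from symmetry. The ambient inner product would not
  do, since \<open>x \<bullet> x\<close> is in general not determined by the eigenvalues.\<close>

definition trace_form :: "'v \<Rightarrow> 'v \<Rightarrow> real" where
  "trace_form x y = (\<Sum>i\<in>UNIV. eig x $ i * coord (eigenframe x i) y)"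

lemma trace_form_sym: "trace_form x y = trace_form y x"
  using coord_swap[OF eigenframe(1) eigenframe(1), of "eig x" x "eig y" y]
  by (simp add: trace_form_def flip: eigenframe(2))

lemma trace_form_self: "trace_form x x = eig x \<bullet> eig x"
  using eigenvalues_coord[OF eigenframe] by (simp add: trace_form_def inner_vec_def)

lemma trace_form_linear_right:
  "trace_form x (y + z) = trace_form x y + trace_form x z"
  "trace_form x (y - z) = trace_form x y - trace_form x z"
  by (simp_all add: trace_form_def coord_linear algebra_simps sum.distrib sum_subtractf)

lemma trace_form_linear_left:
  "trace_form (y + z) x = trace_form y x + trace_form z x"
  "trace_form (y - z) x = trace_form y x - trace_form z x"
  by (metis trace_form_sym trace_form_linear_right)+

text \<open>The hypothesis amounts to \<open>trace_form x a = eig x \<bullet> eig a\<close>, so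
  \<open>eig (a + x)\<close> and \<open>eig a + eig x\<close> have equal norms, which turns the
  majorization between them into equality.\<close>

lemma strongly_operator_commute_of_diff:
  assumes "eig (x - a) \<bullet> eig (x - a) = (eig x - eig a) \<bullet> (eig x - eig a)"
  shows "strongly_operator_commute TYPE('n) jp e a x"
proof -
  have "trace_form (a + x) (a + x) + trace_form (x - a) (x - a) = 2 * trace_form x x + 2 * trace_form a a"
    by (simp add: trace_form_linear_left trace_form_linear_right)
  then have "(eig a + eig x) \<bullet> (eig a + eig x) = eig (a + x) \<bullet> eig (a + x)"
    unfolding trace_form_self assms
    by (simp add: inner_add_left inner_add_right inner_diff_left inner_diff_right inner_commute)
  then have "eig (a + x) = eig a + eig x"
    using eigenvalues_add_sum_le[of _ a x] spectral_decomposition(2)[of "a + x"]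
    by (intro majorized_norm_eq) (auto simp: trace_add sum.distrib)
  then show ?thesis by (rule strongly_operator_commute_of_add)
qed

text \<open>The partial sums of the eigenvalues are convex along the segment from \<open>a\<close> to \<open>x\<close>, with the
  frame at each point giving a subgradient. Single eigenvalues are differences of two such sums;
  over a subdivision of mesh \<open>1/m\<close> the errors telescope to \<open>O(1/m)\<close>.\<close>

lemma lidskii_sum_le:
  assumes I: "initial_segment I" and J: "card J = card I"
  shows "(\<Sum>i\<in>J. (eig x - eig a) $ i) \<le> (\<Sum>i\<in>I. eig (x - a) $ i)"
proof -
  define d where "d = x - a"
  define z where "z = (\<lambda>s. a + s *\<^sub>R d)"
  define g where "g = (\<lambda>s. eigenframe (z s))"
  define P where "P = (\<lambda>A s. \<Sum>i\<in>A. coord (g s i) d)"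
  define S where "S = (\<lambda>A s. \<Sum>i\<in>A. eig (z s) $ i)"
  \<comment> \<open>Collects the slopes whose increments are the error terms. Only
    \<open>R 1 - R 0\<close> survives, so the chosen frames need not vary continuously with
    \<open>s\<close>.\<close>
  define R where "R = (\<lambda>s. \<Sum>i\<in>J. P {..i} s)"
  define B where "B = (\<Sum>i\<in>I. eig d $ i)"
  have g: "frame (g s)" "z s = combine (eig (z s)) (g s)" for s
    unfolding g_def by (rule eigenframe)+
  have subgrad: "S A s + (t - s) * P A s \<le> S A t" if A: "initial_segment A" for A s t
  proof -
    have "z t = z s + (t - s) *\<^sub>R d" by (simp add: z_def algebra_simps)
    then have "(\<Sum>i\<in>A. coord (g s i) (z t)) = S A s + (t - s) * P A s"
      using eigenvalues_coord[OF g]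
      by (simp add: coord_linear S_def P_def sum.distrib sum_distrib_left)
    then show ?thesis
      using coord_sum_le_eigenvalues[OF g(1) A refl, of s "z t"] by (simp add: S_def)
  qed
  have split: "(\<Sum>i\<in>{..i}. h i) = h i + (\<Sum>i\<in>{..<i}. h i)" for h :: "'n \<Rightarrow> real" and i
  proof -
    have "{..i} = insert i {..<i}" by auto
    then show ?thesis by simp
  qed
  have step: "(\<Sum>i\<in>J. eig (z t) $ i) - (\<Sum>i\<in>J. eig (z s) $ i) \<le> (t - s) * (R t - R s) + (t - s) * B"
    if "s \<le> t" for s t
  proof -
    \<comment> \<open>The sum over \<open>{..i}\<close> is bounded above with its slope at
      \<open>t\<close>, the one over \<open>{..<i}\<close> below with its slope at \<open>s\<close>;
      moving the former slope to \<open>s\<close> costs the difference of the \<open>P\<close>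
      terms.\<close>
    have "eig (z t) $ i - eig (z s) $ i
        \<le> (t - s) * (P {..i} t - P {..i} s) + (t - s) * coord (g s i) d" for i
    proof -
      have "S {..i} t - S {..i} s \<le> (t - s) * P {..i} t"
        using subgrad[of "{..i}" t s] by (simp add: algebra_simps)
      moreover have "(t - s) * P {..<i} s \<le> S {..<i} t - S {..<i} s"
        using subgrad[of "{..<i}" s t] by simp
      moreover have "P {..i} s = coord (g s i) d + P {..<i} s"
        "S {..i} r = eig (z r) $ i + S {..<i} r" for r
        unfolding P_def S_def by (rule split)+
      ultimately show ?thesis by (simp add: algebra_simps)
    qed
    then have "(\<Sum>i\<in>J. eig (z t) $ i - eig (z s) $ i)
        \<le> (\<Sum>i\<in>J. (t - s) * (P {..i} t - P {..i} s) + (t - s) * coord (g s i) d)"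
      by (rule sum_mono)
    also have "\<dots> = (t - s) * (R t - R s) + (t - s) * P J s"
      by (simp add: R_def P_def sum.distrib sum_subtractf sum_distrib_left right_diff_distrib)
    also have "\<dots> \<le> (t - s) * (R t - R s) + (t - s) * B"
      using coord_sum_le_eigenvalues[OF g(1) I J, of s d] that
      by (intro add_left_mono mult_left_mono) (auto simp: P_def B_def)
    finally show ?thesis by (simp add: sum_subtractf)
  qed
  define L where "L = (\<lambda>s. \<Sum>i\<in>J. eig (z s) $ i)"
  have bound: "real m * (L 1 - L 0 - B) \<le> R 1 - R 0" if m: "m > 0" for m
  proof -
    define s where "s = (\<lambda>k. real k / real m)"
    have ds: "s (Suc k) - s k = 1 / real m" for k by (simp add: s_def diff_divide_distrib[symmetric])
    have "L (s m) - L (s 0) = (\<Sum>k<m. L (s (Suc k)) - L (s k))"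
      by (rule sum_lessThan_telescope[symmetric])
    also have "\<dots> \<le> (\<Sum>k<m. (1 / real m) * (R (s (Suc k)) - R (s k)) + (1 / real m) * B)"
      using step[of "s k" "s (Suc k)" for k] m unfolding ds L_def
      by (intro sum_mono) (simp add: s_def divide_right_mono)
    also have "\<dots> = (1 / real m) * (R (s m) - R (s 0)) + B"
      using m sum_lessThan_telescope[of "\<lambda>k. R (s k)" m]
      by (simp add: sum.distrib flip: sum_divide_distrib)
    finally show ?thesis using m by (simp add: s_def field_simps)
  qed
  have "L 1 - L 0 \<le> B"
  proof (rule ccontr)
    assume "\<not> L 1 - L 0 \<le> B"
    then obtain m where m: "max 0 (R 1 - R 0) < real m * (L 1 - L 0 - B)"
      using ex_less_of_nat_mult[of "L 1 - L 0 - B" "max 0 (R 1 - R 0)"] by auto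
    then have "m > 0" by (intro gr0I) auto
    then show False using bound[of m] m by simp
  qed
  then show ?thesis by (simp add: L_def B_def z_def d_def sum_subtractf)
qed

lemma eigenvalues_diff_majorized: "majorized (eig x - eig a) (eig (x - a))"
proof (rule majorized_nonincreasingI)
  show "(\<Sum>i\<in>UNIV. (eig x - eig a) $ i) = (\<Sum>i\<in>UNIV. eig (x - a) $ i)"
    using trace_add[of "x - a" a] by (simp add: sum_subtractf)
  show "(\<Sum>i\<in>J. (eig x - eig a) $ i) \<le> (\<Sum>i\<in>I. eig (x - a) $ i)"
    if "initial_segment I" "card J = card I" for I J
    using that by (rule lidskii_sum_le)
qed (rule spectral_decomposition(2))

section \<open>Optimality over spectral sets\<close>

lemma spectral_function_combine:
  assumes "spectral_function jp e F f" "frame c"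
  shows "F (combine u c) = f u"
  using assms eigenvalues_combine_rearranged[OF assms(2), of u]
  unfolding spectral_function_def symmetric_function_def
  by (metis decreasing_rearrangement_obtain)

lemma spectral_set_combine:
  assumes "spectral_set jp e \<Omega> Q" "frame c" "u \<in> Q"
  shows "combine u c \<in> \<Omega>"
  using assms eigenvalues_combine_rearranged[OF assms(2), of u]
  unfolding spectral_set_def symmetric_set_def
  by (metis (mono_tags, lifting) decreasing_rearrangement_obtain mem_Collect_eq)

lemma combine_add: "combine u c + combine v c = combine (u + v) c"
  by (simp add: combine_def scaleR_left_distrib sum.distrib)

lemma combine_diff: "combine u c - combine v c = combine (u - v) c"
  by (simp add: combine_def scaleR_left_diff_distrib sum_subtractf)

lemma spectral_minimizer:
  assumes F: "spectral_function jp e F f" and f: "strictly_schur_convex f"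
    and \<Omega>: "spectral_set jp e \<Omega> Q" and xb: "is_arg_min (\<lambda>x. F (x - a)) (\<lambda>x. x \<in> \<Omega>) xb"
  shows "strongly_operator_commute TYPE('n) jp e a xb"
    and "has_minimum (\<lambda>x. F (x - a)) \<Omega> (f (eig xb - eig a))"
    and "has_minimum (\<lambda>u. f (u - eig a)) Q (f (eig xb - eig a))"
proof -
  obtain c where c: "frame c" "a = combine (eig a) c" using spectral_decomposition by blast
  have xb': "xb \<in> \<Omega>" "\<And>y. y \<in> \<Omega> \<Longrightarrow> F (xb - a) \<le> F (y - a)"
    using xb unfolding is_arg_min_def by (auto simp: not_less)
  have Fu: "F (combine u c - a) = f (u - eig a)" for u
    using spectral_function_combine[OF F c(1)] c(2) by (metis combine_diff)
  have Q: "eig xb \<in> Q" using xb'(1) \<Omega> by (simp add: spectral_set_def)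
  have lower: "F (xb - a) \<le> f (u - eig a)" if "u \<in> Q" for u
    using xb'(2)[OF spectral_set_combine[OF \<Omega> c(1) that]] Fu by simp
  have Fx: "F (xb - a) = f (eig (xb - a))" using F by (simp add: spectral_function_def)
  note maj = eigenvalues_diff_majorized[of xb a]
  have "f (eig xb - eig a) \<le> f (eig (xb - a))"
    using f maj unfolding strictly_schur_convex_def by blast
  then have eq: "F (xb - a) = f (eig xb - eig a)" using lower[OF Q] Fx by simp
  show "has_minimum (\<lambda>x. F (x - a)) \<Omega> (f (eig xb - eig a))"
    unfolding has_minimum_def eq[symmetric] using xb' by blast
  show "has_minimum (\<lambda>u. f (u - eig a)) Q (f (eig xb - eig a))"
    using Q lower unfolding has_minimum_def eq by blast
  have "\<not> f (eig xb - eig a) < f (eig (xb - a))" using eq Fx by simp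
  then have "decreasing_rearrangement (eig xb - eig a) = eig (xb - a)"
    using f maj decreasing_rearrangement_nonincreasing[OF spectral_decomposition(2)[of "xb - a"]]
    unfolding strictly_schur_convex_def by metis
  \<comment> \<open>The permutation is unknown, so only the norm is carried over to
    \<open>strongly_operator_commute_of_diff\<close>.\<close>
  then obtain p where p: "bij p" "eig (xb - a) = permute_coords p (eig xb - eig a)"
    using decreasing_rearrangement_obtain by metis
  have "eig (xb - a) \<bullet> eig (xb - a) = (eig xb - eig a) \<bullet> (eig xb - eig a)"
    unfolding p(2) inner_vec_def permute_coords_def
    using sum.reindex_bij_betw[OF p(1), of "\<lambda>i. (eig xb - eig a) $ i \<bullet> (eig xb - eig a) $ i"] by simp
  then show "strongly_operator_commute TYPE('n) jp e a xb"
    by (rule strongly_operator_commute_of_diff)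
qed

lemma spectral_maximizer:
  assumes F: "spectral_function jp e F f" and f: "strictly_schur_convex f"
    and \<Omega>: "spectral_set jp e \<Omega> Q" and xb: "is_arg_max (\<lambda>x. F (x - a)) (\<lambda>x. x \<in> \<Omega>) xb"
  shows "strongly_operator_commute TYPE('n) jp e (- a) xb"
    and "has_maximum (\<lambda>x. F (x - a)) \<Omega> (f (eig xb + eig (- a)))"
    and "has_maximum (\<lambda>u. f (u + eig (- a))) Q (f (eig xb + eig (- a)))"
proof -
  obtain c where c: "frame c" "- a = combine (eig (- a)) c" using spectral_decomposition by blast
  have xb': "xb \<in> \<Omega>" "\<And>y. y \<in> \<Omega> \<Longrightarrow> F (y - a) \<le> F (xb - a)"
    using xb unfolding is_arg_max_def by (auto simp: not_less)
  have Fu: "F (combine u c - a) = f (u + eig (- a))" for u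
    using spectral_function_combine[OF F c(1)] c(2) by (metis combine_add diff_conv_add_uminus)
  have Q: "eig xb \<in> Q" using xb'(1) \<Omega> by (simp add: spectral_set_def)
  have upper: "f (u + eig (- a)) \<le> F (xb - a)" if "u \<in> Q" for u
    using xb'(2)[OF spectral_set_combine[OF \<Omega> c(1) that]] Fu by simp
  have Fx: "F (xb - a) = f (eig (- a + xb))" using F by (simp add: spectral_function_def)
  note maj = eigenvalues_add_majorized[of "- a" xb]
  have "f (eig (- a + xb)) \<le> f (eig xb + eig (- a))"
    using f maj unfolding strictly_schur_convex_def by (metis add.commute)
  then have eq: "F (xb - a) = f (eig xb + eig (- a))" using upper[OF Q] Fx by simp
  show "has_maximum (\<lambda>x. F (x - a)) \<Omega> (f (eig xb + eig (- a)))"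
    unfolding has_maximum_def eq[symmetric] using xb' by blast
  show "has_maximum (\<lambda>u. f (u + eig (- a))) Q (f (eig xb + eig (- a)))"
    using Q upper unfolding has_maximum_def eq by blast
  \<comment> \<open>Both sides of the majorization are sorted, so equal rearrangements mean equal
    vectors.\<close>
  have "nonincreasing (eig (- a) + eig xb)"
    using spectral_decomposition(2)[of "- a"] spectral_decomposition(2)[of xb]
    by (simp add: nonincreasing_def add_mono)
  moreover have "\<not> f (eig (- a + xb)) < f (eig (- a) + eig xb)"
    using eq Fx by (simp add: add.commute)
  ultimately have "eig (- a + xb) = eig (- a) + eig xb"
    using f maj decreasing_rearrangement_nonincreasing spectral_decomposition(2)
    unfolding strictly_schur_convex_def by metis
  then show "strongly_operator_commute TYPE('n) jp e (- a) xb"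
    by (rule strongly_operator_commute_of_add)
qed

end

theorem theorem4p1:
  fixes jp :: "'v::euclidean_space \<Rightarrow> 'v \<Rightarrow> 'v" and e a :: 'v
    and F :: "'v \<Rightarrow> real" and f :: "real ^ 'n::{finite,linorder} \<Rightarrow> real"
    and \<Omega> :: "'v set" and Q :: "(real ^ 'n::{finite,linorder}) set"
  assumes "euclidean_jordan_algebra jp e"
    and "has_rank jp e CARD('n)"
    and "spectral_function jp e F f"
    and "strictly_schur_convex f"
    and "spectral_set jp e \<Omega> Q"
  shows "(\<forall>xb. is_arg_min (\<lambda>x. F (x - a)) (\<lambda>x. x \<in> \<Omega>) xb \<longrightarrow>
            strongly_operator_commute TYPE('n) jp e a xb \<and>
            has_minimum (\<lambda>x. F (x - a)) \<Omega> (f (eigenvalues jp e xb - eigenvalues jp e a)) \<and>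
            has_minimum (\<lambda>u. f (u - eigenvalues jp e a)) Q
              (f (eigenvalues jp e xb - eigenvalues jp e a))) \<and>
         (\<forall>xb. is_arg_max (\<lambda>x. F (x - a)) (\<lambda>x. x \<in> \<Omega>) xb \<longrightarrow>
            strongly_operator_commute TYPE('n) jp e (- a) xb \<and>
            has_maximum (\<lambda>x. F (x - a)) \<Omega> (f (eigenvalues jp e xb + eigenvalues jp e (- a))) \<and>
            has_maximum (\<lambda>u. f (u + eigenvalues jp e (- a))) Q
              (f (eigenvalues jp e xb + eigenvalues jp e (- a))))"
proof -
  interpret ranked_euclidean_jordan_algebra jp e "TYPE('n)"
    using assms(1,2)
    by (simp add: ranked_euclidean_jordan_algebra_def ranked_euclidean_jordan_algebra_axioms_def)
  show ?thesis
    using spectral_minimizer[OF assms(3-5)] spectral_maximizer[OF assms(3-5)] by blast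
qed

end
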